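(* Let $h\geq 3$ and let $H$ be a graph. The graph $G_H$ is a minimal non $[h,2,1]$ graph if and only if $H$ is $(h+1)$-critical.
   Context: All graphs are finite, simple and connected. Given a graph $H$ with $V(H)=\{v_1,\dots,v_n\}$, $G_H$ is the graph with vertex set consisting of: $v_i$ for each $1\le i\le n$; $v_{ij}$ for each $1\le i<j\le n$ with $v_iv_j\in E(H)$; and $\tilde v_i$ for each $i$ with $d_H(v_i)=1$. Its edges: the set $K_H=\{v_{ij}\}\cup\{\tilde v_i\}$ is complete; the vertices $v_1,\dots,v_n$ form a stable set; $v_i$ is adjacent to $v_{ij}$ (resp. $v_{ji}$) for each edge $v_iv_j$ of $H$ and to $\tilde v_i$ if $d_H(v_i)=1$; there are no other edges. (So the cliques of $G_H$ are $K_H$ and $C_{v_i}=\{v_i\}\cup\{v_{ij}: v_j\in N_H(v_i)\}\cup\{\tilde v_i \text{ if } d_H(v_i)=1\}$.) A VPT representation of $G$ is a tree $T$ with paths $(P_v)_{v\in V(G)}$ of $T$ such that $uv\in E(G)$ iff $P_u,P_v$ share a vertex. $[h,2,1]$ is the class of graphs admitting a VPT representation whose host tree has maximum degree at most $h$. A minimal non $[h,2,1]$ graph is a graph $G\notin[h,2,1]$ with $G-v\in[h,2,1]$ for all $v\in V(G)$. A graph with chromatic number $k$ is $k$-critical if deleting any vertex or any edge lowers the chromatic number. *)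

theory Defs
  imports "Graph_Theory.Graph_Theory"
begin

text \<open>
  Finite simple graphs are symmetric loop-free digraphs without parallel arcs, i.e. the locales
  \<^const>\<open>graph\<close> and \<^const>\<open>pair_graph\<close>: an undirected edge is a pair of opposite arcs, and the degree
  of a vertex is its \<^const>\<open>out_degree\<close>.
\<close>

definition del_edge :: "('a, 'b) pre_digraph \<Rightarrow> 'a \<Rightarrow> 'a \<Rightarrow> ('a, 'b) pre_digraph" where
  "del_edge G u v = \<lparr> verts = verts G,
     arcs = {a \<in> arcs G. arc_to_ends G a \<noteq> (u, v) \<and> arc_to_ends G a \<noteq> (v, u)},
     tail = tail G, head = head G \<rparr>"

definition colorable :: "nat \<Rightarrow> ('a, 'b) pre_digraph \<Rightarrow> bool" where
  "colorable k G \<longleftrightarrow> (\<exists>c :: 'a \<Rightarrow> nat. (\<forall>v \<in> verts G. c v < k) \<and>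
     (\<forall>u v. u \<rightarrow>\<^bsub>G\<^esub> v \<longrightarrow> c u \<noteq> c v))"

definition chromatic_number :: "('a, 'b) pre_digraph \<Rightarrow> nat" where
  "chromatic_number G = (LEAST k. colorable k G)"

definition critical :: "nat \<Rightarrow> ('a, 'b) pre_digraph \<Rightarrow> bool" where
  "critical k G \<longleftrightarrow> chromatic_number G = k \<and>
     (\<forall>v \<in> verts G. chromatic_number (pre_digraph.del_vert G v) < k) \<and>
     (\<forall>u v. u \<rightarrow>\<^bsub>G\<^esub> v \<longrightarrow> chromatic_number (del_edge G u v) < k)"

text \<open>
  The constant \<^const>\<open>tree\<close> is of no use here: it forbids all directed cycles, hence also the
  2-cycle formed by the two arcs of a single undirected edge. Undirected cycles are the directed
  cycles of length at least 3.
\<close>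

definition undirected_tree :: "'t pair_pre_digraph \<Rightarrow> bool" where
  "undirected_tree T \<longleftrightarrow> pair_graph T \<and> connected T \<and>
     \<not> (\<exists>p. pre_digraph.cycle T p \<and> length p \<ge> 3)"

text \<open>A path may consist of a single vertex, but it is never empty.\<close>

definition VPT_representation ::
    "'t pair_pre_digraph \<Rightarrow> ('a \<Rightarrow> 't list) \<Rightarrow> ('a, 'b) pre_digraph \<Rightarrow> bool" where
  "VPT_representation T P G \<longleftrightarrow> undirected_tree T \<and> (\<forall>v \<in> verts G. vpath (P v) T) \<and>
     (\<forall>u \<in> verts G. \<forall>v \<in> verts G. u \<noteq> v \<longrightarrow> (u \<rightarrow>\<^bsub>G\<^esub> v \<longleftrightarrow> set (P u) \<inter> set (P v) \<noteq> {}))"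

text \<open>
  The class \<open>[h,2,1]\<close>. Host trees are finite, so it is no restriction to take their vertices
  in \<^typ>\<open>nat\<close>.
\<close>

definition in_h21 :: "nat \<Rightarrow> ('a, 'b) pre_digraph \<Rightarrow> bool" where
  "in_h21 h G \<longleftrightarrow> graph G \<and> (\<exists>(T :: nat pair_pre_digraph) P.
     VPT_representation T P G \<and> (\<forall>t \<in> verts T. out_degree T t \<le> h))"

definition minimal_non_h21 :: "nat \<Rightarrow> ('a, 'b) pre_digraph \<Rightarrow> bool" where
  "minimal_non_h21 h G \<longleftrightarrow> graph G \<and> \<not> in_h21 h G \<and>
     (\<forall>v \<in> verts G. in_h21 h (pre_digraph.del_vert G v))"

text \<open>
  \<open>Orig v\<close> is \<open>v\<close> itself, \<open>EdgeV {u, v}\<close> is the vertex indexed by the edge \<open>uv\<close> (as an unordered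
  pair), and \<open>Tilde v\<close> is the additional neighbour of a vertex \<open>v\<close> of degree 1.
\<close>

datatype 'a GH_vertex = Orig 'a | EdgeV "'a set" | Tilde 'a

definition GH_clique :: "'a pair_pre_digraph \<Rightarrow> 'a GH_vertex set" where
  "GH_clique H = {EdgeV {u, v} | u v. u \<rightarrow>\<^bsub>H\<^esub> v} \<union> {Tilde v | v. v \<in> verts H \<and> out_degree H v = 1}"

definition GH_cross :: "'a pair_pre_digraph \<Rightarrow> 'a GH_vertex rel" where
  "GH_cross H = {(Orig u, EdgeV {u, v}) | u v. u \<rightarrow>\<^bsub>H\<^esub> v} \<union>
     {(Orig v, Tilde v) | v. v \<in> verts H \<and> out_degree H v = 1}"

definition GH :: "'a pair_pre_digraph \<Rightarrow> 'a GH_vertex pair_pre_digraph" where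
  "GH H = \<lparr> pverts = Orig ` verts H \<union> GH_clique H,
     parcs = {(x, y). x \<in> GH_clique H \<and> y \<in> GH_clique H \<and> x \<noteq> y} \<union>
       GH_cross H \<union> (GH_cross H)\<inverse> \<rparr>"

end

theory Submission
  imports Defs
begin

text \<open>
  In a host tree of maximum degree \<open>h\<close> the pairwise meeting paths of the clique \<open>K\<^sub>H\<close> share a vertex
  \<open>q\<close> by the Helly property, and the path of no original vertex \<open>v\<close> contains \<open>q\<close>, since some clique
  vertex is not adjacent to \<open>v\<close>. Colouring \<open>v\<close> by the branch at \<open>q\<close> that contains its path is
  proper: if adjacent \<open>u\<close> and \<open>v\<close> lay in one branch, the path of the edge \<open>uv\<close> would reach one of
  them through the other, say \<open>v\<close> through \<open>u\<close>, and then so would every clique path meeting \<open>v\<close>;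
  but some clique vertex is adjacent to \<open>v\<close> and not to \<open>u\<close>. Conversely an \<open>h\<close>-colouring of \<open>H\<close> gives
  a host tree with \<open>h\<close> caterpillars joined at a root, one for each colour. So \<open>G\<^sub>H\<close> is in \<open>[h,2,1]\<close> iff
  \<open>H\<close> is \<open>h\<close>-colourable.

  Deleting the vertex \<open>b\<close> from \<open>G\<^sub>H\<close> corresponds in the same way to deleting it from \<open>H\<close>. Hence, if
  \<open>G\<^sub>H\<close> is minimal, every \<open>H - b\<close> is \<open>h\<close>-colourable while \<open>H\<close> is not, so all degrees are at least
  \<open>h \<ge> 3\<close>. This leaves every vertex enough neighbours in the clique to run the colouring argument
  also after the deletion of an edge vertex.
\<close>

section \<open>Walks in trees\<close>

text \<open>Walks are used instead of paths so that transitivity is concatenation;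
  \<open>linked_vpath\<close> recovers a path when one is needed. With \<open>S\<close> the set of
  vertices other than \<open>a\<close>, the relation says that \<open>a\<close> does not separate
  \<open>x\<close> from \<open>y\<close>.\<close>

definition linked :: "('a, 'b) pre_digraph \<Rightarrow> 'a set \<Rightarrow> 'a \<Rightarrow> 'a \<Rightarrow> bool" where
  "linked G S x y \<longleftrightarrow> (\<exists>w. vwalk w G \<and> hd w = x \<and> last w = y \<and> set w \<subseteq> S)"

text \<open>Connectedness of a vertex set, the form in which the Helly argument can pass from paths
  to their intersections.\<close>

definition subtree :: "('a, 'b) pre_digraph \<Rightarrow> 'a set \<Rightarrow> bool" where
  "subtree G S \<longleftrightarrow> (\<forall>x\<in>S. \<forall>y\<in>S. linked G S x y)"

lemma linkedI: "vwalk w G \<Longrightarrow> hd w = x \<Longrightarrow> last w = y \<Longrightarrow> set w \<subseteq> S \<Longrightarrow> linked G S x y"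
  unfolding linked_def by blast

lemma linked_mono: "linked G S x y \<Longrightarrow> S \<subseteq> S' \<Longrightarrow> linked G S' x y"
  unfolding linked_def by blast

lemma linked_trans:
  assumes "linked G S x y" "linked G S y z"
  shows "linked G S x z"
proof -
  obtain v w where v: "vwalk v G" "hd v = x" "last v = y" "set v \<subseteq> S"
    and w: "vwalk w G" "hd w = y" "last w = z" "set w \<subseteq> S"
    using assms unfolding linked_def by blast
  have ne: "v \<noteq> []" "w \<noteq> []" using v w by auto
  show ?thesis
  proof (rule linkedI)
    show "vwalk (v \<oplus> w) G"
      using v w ne by (intro vwalk_joinI_vwalk) (auto simp: joinable_def)
    show "hd (v \<oplus> w) = x"
      using v w ne by (simp add: vwalk_join_hd)
    show "last (v \<oplus> w) = z"
      using v w ne by (intro trans[OF vwalk_join_last]) (auto simp: joinable_def)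
    show "set (v \<oplus> w) \<subseteq> S"
      using v w ne by (auto simp: vwalk_join_def dest: list.set_sel(2))
  qed
qed

lemma linked_vpath:
  assumes "linked G S x y"
  obtains p where "vpath p G" "hd p = x" "last p = y" "set p \<subseteq> S"
proof -
  obtain w where "vwalk w G" "hd w = x" "last w = y" "set w \<subseteq> S"
    using assms unfolding linked_def by blast
  then show thesis
    using that[of "vwalk_to_vpath w"] vwalk_to_vpath_vpath vwalk_to_vpath_subset
    by (metis subset_eq vwalk_to_vpath_hd vwalk_to_vpath_last)
qed

lemma linked_sym:
  assumes "symmetric G" "linked G S x y"
  shows "linked G S y x"
proof -
  obtain w where w: "vwalk w G" "hd w = x" "last w = y" "set w \<subseteq> S"
    using assms unfolding linked_def by blast
  have "vwalk (rev w) G"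
  proof
    show "set (vwalk_arcs (rev w)) \<subseteq> arcs_ends G"
      using w(1) assms(1) unfolding set_vwalk_arcs_rev symmetric_def sym_def vwalk_def by blast
  qed (use w in auto)
  then show ?thesis
    using w by (intro linkedI[of "rev w"]) (auto simp: hd_rev last_rev)
qed

lemma vwalk_slice:
  assumes "vwalk p G" "i \<le> j" "j < length p"
  defines "w \<equiv> drop i (take (Suc j) p)"
  shows "vwalk w G" "hd w = p ! i" "last w = p ! j"
proof -
  have ne: "w \<noteq> []" using assms by auto
  have "vwalk (take (Suc j) p) G"
    using assms by (intro vwalkI_append_l[of "take (Suc j) p" "drop (Suc j) p"]) auto
  then show "vwalk w G"
    using ne unfolding w_def
    by (intro vwalkI_append_r[of "drop i (take (Suc j) p)" "take i (take (Suc j) p)"])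
      (simp_all del: take_take)
  show "hd w = p ! i" "last w = p ! j"
    using assms ne by (auto simp: hd_drop_conv_nth last_conv_nth)
qed

lemma vpath_subtree:
  assumes "symmetric G" "vpath p G"
  shows "subtree G (set p)"
  unfolding subtree_def
proof (intro ballI)
  fix x y assume "x \<in> set p" "y \<in> set p"
  then obtain i j where ij: "x = p ! i" "y = p ! j" "i < length p" "j < length p"
    by (metis in_set_conv_nth)
  have *: "linked G (set p) (p ! i) (p ! j)" if "i \<le> j" "j < length p" for i j
    using vwalk_slice[of p G i j] that assms(2)
    by (intro linkedI[of "drop i (take (Suc j) p)"])
      (auto simp: vpath_def dest: in_set_dropD in_set_takeD)
  show "linked G (set p) x y"
    using *[of i j] *[of j i] ij linked_sym[OF assms(1)] by (cases "i \<le> j") auto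
qed

text \<open>Bridge between vertex lists, which describe host paths, and arc lists, in terms of which
  \<open>cycle\<close> is defined.\<close>

lemma vwalk_awalk:
  assumes "pair_graph T" "vwalk w (with_proj T)"
  shows "pre_digraph.awalk (with_proj T) (hd w) (vwalk_arcs w) (last w) \<and>
    pawalk_verts (hd w) (vwalk_arcs w) = w"
proof -
  interpret pair_graph T by fact
  show ?thesis
    using assms(2)
  proof (induction w rule: vwalk_induct)
    case (Base u)
    then show ?case by (simp add: awalk_Nil_iff)
  next
    case (Cons u v es)
    then show ?case by (auto simp: awalk_Cons_iff)
  qed
qed

text \<open>At least two vertices in \<open>w\<close> give the closed walk at least three arcs, so
  it is not the 2-cycle of a single edge.\<close>

lemma undirected_tree_no_cycle:
  assumes "undirected_tree T" "vwalk (a # w @ [a]) (with_proj T)" "distinct (w @ [a])" "length w \<ge> 2"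
  shows False
proof -
  have pg: "pair_graph T" using assms(1) unfolding undirected_tree_def by blast
  let ?p = "vwalk_arcs (a # w @ [a])"
  have *: "pre_digraph.awalk (with_proj T) a ?p a" "pawalk_verts a ?p = a # w @ [a]"
    using vwalk_awalk[OF pg assms(2)] by auto
  have len: "length ?p \<ge> 3"
    using vwalk_length_simp[of "a # w @ [a]"] assms(4) unfolding vwalk_length_def
    by (simp del: vwalk_arcs_Cons)
  then have "pre_digraph.cycle (with_proj T) ?p"
    unfolding pre_digraph.cycle_def awalk_verts_with_proj_eq using * assms(3)
    by (intro exI[of _ a]) auto
  then show False
    using assms(1) len unfolding undirected_tree_def by blast
qed

section \<open>The Helly property of subtrees, and colouring by the branches at a vertex\<close>

context
  fixes T :: "'t pair_pre_digraph"
  assumes tree: "undirected_tree T"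
begin

lemma tree_pair_graph: "pair_graph T"
  using tree unfolding undirected_tree_def by blast

lemma tree_symmetric: "symmetric (with_proj T)"
  using tree_pair_graph pair_graph.axioms pair_pseudo_graph.axioms pair_sym_digraph.pair_sym_arcs by blast

lemma tree_linked:
  assumes "x \<in> verts T" "y \<in> verts T"
  shows "linked T (verts T) x y"
proof -
  interpret pair_graph T by (rule tree_pair_graph)
  have "connected T" using tree unfolding undirected_tree_def by blast
  then have "strongly_connected T"
    using symmetric_connected_imp_strongly_connected tree_symmetric by blast
  then have "x \<rightarrow>\<^sup>*\<^bsub>T\<^esub> y" using assms by auto
  then show ?thesis
    unfolding reachable_vwalk_conv linked_def by (auto simp: vwalk_def)
qed

text \<open>A walk from one end of a path to the other that avoids a vertex \<open>a\<close> of the path would close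
  up to a cycle through \<open>a\<close> and its two neighbours on the path.\<close>

lemma vpath_subset_linked:
  assumes p: "vpath p T" and S: "linked T S (hd p) (last p)"
  shows "set p \<subseteq> S"
proof (rule ccontr)
  assume "\<not> set p \<subseteq> S"
  then obtain a where a: "a \<in> set p" "a \<notin> S" by blast
  then obtain p1 p2 where split: "p = p1 @ a # p2" by (meson split_list)
  have wp: "vwalk p T" "distinct p" using p by auto
  obtain w where w: "vwalk w T" "hd w = hd p" "last w = last p" "set w \<subseteq> S"
    using S unfolding linked_def by blast
  have "w \<noteq> []" using w by auto
  then have "hd p \<in> S" "last p \<in> S" using w by (metis hd_in_set last_in_set subsetD)+
  then have ne: "p1 \<noteq> []" "p2 \<noteq> []" using a split by auto
  have wp1: "vwalk p1 T" using wp ne split vwalkI_append_l by blast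
  have wp2: "vwalk p2 T"
    using wp ne split vwalkI_append_r[of p2 "p1 @ [a]"] by simp
  have arc1: "(last p1, a) \<in> arcs_ends T" and arc2: "(a, hd p2) \<in> arcs_ends T"
    using wp(1) ne unfolding split vwalk_def
    by (simp_all add: vwalk_arcs_append)
  \<comment> \<open>Both halves of \<open>p\<close> and the walk \<open>w\<close> avoid
    \<open>a\<close>, so the two neighbours of \<open>a\<close> on \<open>p\<close> are joined
    without passing \<open>a\<close>.\<close>
  let ?V = "verts T - {a}"
  have l1: "linked T ?V (hd p1) (last p1)"
    using wp1 wp split unfolding vwalk_def by (intro linkedI[of p1]) (auto simp: vwalk_def)
  have l2: "linked T ?V (hd p2) (last p2)"
    using wp2 wp split unfolding vwalk_def by (intro linkedI[of p2]) (auto simp: vwalk_def)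
  have l3: "linked T ?V (hd p1) (last p2)"
    using w a split ne by (intro linkedI[of w]) (auto simp: vwalk_def)
  have "linked T ?V (last p1) (hd p2)"
    using l1 l2 l3 linked_sym[OF tree_symmetric] linked_trans by metis
  then obtain r where r: "vpath r T" "hd r = last p1" "last r = hd p2" "set r \<subseteq> ?V"
    by (rule linked_vpath)
  have rne: "r \<noteq> []" using r by auto
  \<comment> \<open>Distinct neighbours force two vertices on \<open>r\<close>, so closing it up
    through \<open>a\<close> yields a cycle of length at least 3.\<close>
  have "last p1 \<noteq> hd p2"
    using wp(2) split ne by (metis IntI append_Cons distinct_append empty_iff hd_in_set last_in_set set_subset_Cons subsetD)
  then have len: "length r \<ge> 2"
    using r(2,3) rne by (cases r) (auto simp: Suc_le_eq split: if_splits)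
  have arc3: "(a, hd r) \<in> arcs_ends T" "(last r, a) \<in> arcs_ends T"
    using arc1 arc2 r tree_symmetric unfolding symmetric_def sym_def by auto
  have "vwalk (a # r @ [a]) T"
    using r(1) rne arc3 a wp(1) unfolding vpath_def vwalk_def
    by (auto simp: set_vwalk_arcs_snoc)
  then show False
    using undirected_tree_no_cycle[OF tree _ _ len] r by auto
qed

text \<open>A path in \<open>A\<close> between two common vertices lies in every connected set
  containing its ends, hence also in \<open>B\<close>.\<close>

lemma subtree_Int:
  assumes "subtree T A" "subtree T B"
  shows "subtree T (A \<inter> B)"
  unfolding subtree_def
proof (intro ballI)
  fix x y assume xy: "x \<in> A \<inter> B" "y \<in> A \<inter> B"
  then have "linked T A x y" "linked T B x y" using assms unfolding subtree_def by auto
  then obtain p where p: "vpath p T" "hd p = x" "last p = y" "set p \<subseteq> A" using linked_vpath by metis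
  then have "set p \<subseteq> B" using vpath_subset_linked \<open>linked T B x y\<close> by blast
  then show "linked T (A \<inter> B) x y" using p by (intro linkedI[of p]) auto
qed

text \<open>Follow a walk in \<open>B\<close> from \<open>a\<close> until it first meets
  \<open>A\<close>, at \<open>m\<close>, and continue inside \<open>A\<close> to \<open>b\<close>.
  The result is a path because \<open>m\<close> is the first vertex in \<open>A\<close>, and
  \<open>C\<close>, being connected and containing both ends, contains all of it, in particular
  \<open>m\<close>.\<close>

lemma subtree_Helly3:
  assumes A: "subtree T A" and B: "subtree T B" and C: "subtree T C"
    and a: "a \<in> B \<inter> C" and b: "b \<in> A \<inter> C" and c: "c \<in> A \<inter> B"
  shows "A \<inter> B \<inter> C \<noteq> {}"
proof -
  obtain w where w: "vwalk w T" "hd w = a" "last w = c" "set w \<subseteq> B"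
    using B a c unfolding subtree_def linked_def by blast
  have "w \<noteq> []" using w by auto
  then have "\<exists>x\<in>set w. x \<in> A" using w c by (metis IntD1 last_in_set)
  then obtain w1 m w2 where sp: "w = w1 @ m # w2" and m: "m \<in> A" and w1: "\<forall>y\<in>set w1. y \<notin> A"
    using split_list_first_prop[of w "\<lambda>x. x \<in> A"] by blast
  have "vwalk (w1 @ [m]) T"
    using w(1) vwalkI_append_l[of "w1 @ [m]" w2] sp by simp
  then have "linked T (set (w1 @ [m])) a m"
    using w(2) sp by (intro linkedI[of "w1 @ [m]"]) (auto simp: hd_append)
  then obtain r where r: "vpath r T" "hd r = a" "last r = m" "set r \<subseteq> set (w1 @ [m])"
    by (rule linked_vpath)
  have "linked T A m b" using A m b unfolding subtree_def by blast
  then obtain s where s: "vpath s T" "hd s = m" "last s = b" "set s \<subseteq> A"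
    by (rule linked_vpath)
  have ne: "r \<noteq> []" "s \<noteq> []" using r s by auto
  obtain s' where s': "s = m # s'" using ne s by (cases s) auto
  have dis: "distinct (r @ s')"
    using r s s' w1 unfolding vpath_def by (auto 4 3)
  have rs: "r \<oplus> s = r @ s'" by (simp add: vwalk_join_def s')
  have "vpath (r @ s') T"
  proof
    show "vwalk (r @ s') T"
      using r s ne unfolding rs[symmetric]
      by (intro vwalk_joinI_vwalk) (auto simp: joinable_def)
  qed (rule dis)
  moreover have "hd (r @ s') = a" "last (r @ s') = b"
    using r s s' ne by (auto simp: last_append)
  moreover have "linked T C a b" using C a b unfolding subtree_def by blast
  ultimately have "set (r @ s') \<subseteq> C" using vpath_subset_linked by metis
  moreover have "m \<in> set r" using r ne by auto
  moreover have "m \<in> B" using sp w by auto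
  ultimately show ?thesis using m by auto
qed

text \<open>The separate set \<open>A\<close> accumulates the intersection of the members already
  treated. In the induction step \<open>subtree_Helly3\<close> shows that \<open>A Int B\<close>
  still meets every remaining member.\<close>

lemma subtree_Helly:
  assumes "finite F" "subtree T A" "A \<noteq> {}"
    and "\<And>S. S \<in> F \<Longrightarrow> subtree T S"
    and "\<And>S. S \<in> F \<Longrightarrow> A \<inter> S \<noteq> {}"
    and "\<And>S S'. S \<in> F \<Longrightarrow> S' \<in> F \<Longrightarrow> S \<inter> S' \<noteq> {}"
  shows "A \<inter> \<Inter>F \<noteq> {}"
  using assms
proof (induction F arbitrary: A rule: finite_induct)
  case empty
  then show ?case by simp
next
  case (insert B F)
  have "(A \<inter> B) \<inter> \<Inter>F \<noteq> {}"
  proof (rule insert.IH)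
    show "subtree T (A \<inter> B)" using insert.prems subtree_Int by simp
    show "A \<inter> B \<noteq> {}" using insert.prems by simp
    show "A \<inter> B \<inter> S \<noteq> {}" if S: "S \<in> F" for S
    proof -
      obtain a b c where "a \<in> B \<inter> S" "b \<in> A \<inter> S" "c \<in> A \<inter> B"
        using insert.prems S by (metis all_not_in_conv insertCI)
      then show ?thesis
        using subtree_Helly3[of A B S a b c] insert.prems S by simp
    qed
  qed (use insert.prems in auto)
  then show ?case by (simp add: Int_assoc)
qed

text \<open>One of three vertices on a path lies between the other two, and then every connection of
  these two passes through it. Each case is named after the middle vertex.\<close>

lemma vpath_middle:
  assumes "vpath p T" "x \<in> set p" "y \<in> set p" "z \<in> set p"
  obtains
    (x) "\<And>S. linked T S y z \<Longrightarrow> x \<in> S"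
  | (y) "\<And>S. linked T S x z \<Longrightarrow> y \<in> S"
  | (z) "\<And>S. linked T S x y \<Longrightarrow> z \<in> S"
proof -
  obtain i j k where ijk: "x = p ! i" "y = p ! j" "z = p ! k"
    "i < length p" "j < length p" "k < length p"
    using assms by (metis in_set_conv_nth)
  have mid: "p ! j \<in> S" if "i \<le> j" "j \<le> k" "k < length p"
    and l: "linked T S (p ! i) (p ! k) \<or> linked T S (p ! k) (p ! i)" for i j k S
  proof -
    let ?w = "drop i (take (Suc k) p)"
    have "vwalk p T" "distinct p" using assms(1) by auto
    note slice = vwalk_slice[OF this(1), of i k]
    have "vpath ?w T" using slice(1) \<open>distinct p\<close> that by (intro vpathI) auto
    moreover have "hd ?w = p ! i" "last ?w = p ! k" using slice that by auto
    moreover have "linked T S (p ! i) (p ! k)"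
      using l linked_sym[OF tree_symmetric] by blast
    ultimately have "set ?w \<subseteq> S" using vpath_subset_linked by metis
    moreover have "p ! j = ?w ! (j - i)" "j - i < length ?w" using that by auto
    ultimately show ?thesis by (metis nth_mem subsetD)
  qed
  consider "j \<le> i \<and> i \<le> k \<or> k \<le> i \<and> i \<le> j" | "i \<le> j \<and> j \<le> k \<or> k \<le> j \<and> j \<le> i"
    | "i \<le> k \<and> k \<le> j \<or> j \<le> k \<and> k \<le> i"
    by linarith
  then show thesis
    using that ijk mid by cases (metis)+
qed

text \<open>Only paths are mentioned, so that the argument serves \<open>GH H\<close> and its
  vertex-deleted subgraphs alike. \<open>K\<close> stands for the clique and \<open>E\<close> for
  the edges to be coloured; \<open>common\<close> is supplied by the edge vertex,
  \<open>own_nb\<close> by a clique vertex adjacent to \<open>u\<close> and not to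
  \<open>v\<close>.\<close>

lemma branch_coloring:
  fixes P :: "'v \<Rightarrow> 't list"
  assumes deg: "\<And>t. t \<in> verts T \<Longrightarrow> out_degree T t \<le> h" and h: "0 < h"
    and K: "finite K" "\<And>k. k \<in> K \<Longrightarrow> vpath (P k) T"
    and KK: "\<And>k l. k \<in> K \<Longrightarrow> l \<in> K \<Longrightarrow> set (P k) \<inter> set (P l) \<noteq> {}"
    and sym: "\<And>u v. E u v \<Longrightarrow> E v u"
    and path: "\<And>u v. E u v \<Longrightarrow> vpath (P u) T"
    and disj: "\<And>u v. E u v \<Longrightarrow> set (P u) \<inter> set (P v) = {}"
    and common: "\<And>u v. E u v \<Longrightarrow> \<exists>k\<in>K. set (P k) \<inter> set (P u) \<noteq> {} \<and> set (P k) \<inter> set (P v) \<noteq> {}"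
    and own_nb: "\<And>u v. E u v \<Longrightarrow> \<exists>k\<in>K. set (P k) \<inter> set (P u) \<noteq> {} \<and> set (P k) \<inter> set (P v) = {}"
  shows "\<exists>c. (\<forall>v. c v < h) \<and> (\<forall>u v. E u v \<longrightarrow> c u \<noteq> c v)"
proof (cases "\<exists>u v. E u v")
  case False
  then show ?thesis using h by (intro exI[of _ "\<lambda>_. 0"]) auto
next
  case True
  then obtain k0 where k0: "k0 \<in> K" using common by blast
  interpret pair_graph T by (rule tree_pair_graph)
  have sub: "subtree T (set p)" if "vpath p T" for p
    using vpath_subtree[OF tree_symmetric that] .
  have vne: "set p \<noteq> {}" "set p \<subseteq> verts T" if "vpath p T" for p
    using that by (auto simp: vpath_def vwalk_def)
  have "set (P k0) \<inter> \<Inter>((\<lambda>k. set (P k)) ` K) \<noteq> {}"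
  proof (rule subtree_Helly)
    show "finite ((\<lambda>k. set (P k)) ` K)" using K by blast
    show "set (P k0) \<noteq> {}" using K k0 by auto
  qed (use K KK k0 sub in auto)
  then obtain q where q: "\<And>k. k \<in> K \<Longrightarrow> q \<in> set (P k)" by blast
  have qV: "q \<in> verts T" using q[OF k0] vne(2)[OF K(2)[OF k0]] by auto
  have qnot: "q \<notin> set (P u)" if "E u v" for u v
    using own_nb[OF sym[OF that]] q by blast
  let ?Q = "verts T - {q}"
  \<comment> \<open>The components of the tree without \<open>q\<close> are named by the neighbours
    \<open>b\<close> of \<open>q\<close>; the path of \<open>u\<close> is assigned the component
    that it meets.\<close>
  define branch where "branch u b \<longleftrightarrow> (q, b) \<in> arcs T \<and> (\<exists>t\<in>set (P u). linked T ?Q b t)" for u b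
  have ex: "\<exists>b. branch u b" if E: "E u v" for u v
  proof -
    have "hd (P u) \<in> set (P u)" using vne(1)[OF path[OF E]] by simp
    then obtain t where t: "t \<in> set (P u)" "t \<in> verts T" using vne(2)[OF path[OF E]] by blast
    obtain p where p: "vpath p T" "hd p = q" "last p = t"
      using linked_vpath[OF tree_linked[OF qV t(2)]] by metis
    have "t \<noteq> q" using qnot[OF E] t by blast
    have "p \<noteq> []" using p by auto
    then obtain b w where w: "p = q # b # w"
      using p \<open>t \<noteq> q\<close> by (cases p; cases "tl p") auto
    have "vwalk (b # w) T" using p w vwalkI_append_r[of "b # w" "[q]"] by auto
    then have "linked T ?Q b t"
      using p w by (intro linkedI[of "b # w"]) (auto simp: vwalk_def vpath_def)
    moreover have "(q, b) \<in> arcs T" using p(1) w by (auto simp: vpath_def vwalk_def)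
    ultimately show ?thesis unfolding branch_def using t by blast
  qed
  \<comment> \<open>Numbering the arcs at \<open>q\<close> turns branches into colours; their number
    is the degree of \<open>q\<close>, at most \<open>h\<close>.\<close>
  obtain f :: "'t \<times> 't \<Rightarrow> nat" and n where f: "f ` out_arcs T q = {i. i < n}" "inj_on f (out_arcs T q)"
    using finite_imp_inj_to_nat_seg[of "out_arcs T q"] by auto
  have "n = out_degree T q"
    unfolding out_degree_def using card_image[OF f(2)] f(1) by simp
  then have fh: "f e < h" if "e \<in> out_arcs T q" for e
  proof -
    have "f e \<in> {i. i < n}" using f(1) that by blast
    then show ?thesis using deg[OF qV] \<open>n = out_degree T q\<close> by simp
  qed
  \<comment> \<open>The default 0 is for vertices without a branch; \<open>0 < h\<close> makes it a
    legal colour.\<close>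
  define c where "c u = (if \<exists>b. branch u b then f (q, SOME b. branch u b) else 0)" for u
  have ch: "c u < h" for u
    using h fh someI_ex[of "branch u"] unfolding c_def branch_def by auto
  have ne: "c u \<noteq> c v" if E: "E u v" for u v
  proof
    assume eq: "c u = c v"
    have Evu: "E v u" using sym E by blast
    define b where "b = (SOME b. branch u b)"
    have bu: "branch u b" unfolding b_def using someI_ex ex[OF E] by metis
    have bv': "branch v (SOME b. branch v b)" using someI_ex ex[OF Evu] by metis
    have "f (q, b) = f (q, SOME b. branch v b)"
      using eq ex[OF E] ex[OF Evu] unfolding c_def b_def by auto
    then have "b = (SOME b. branch v b)"
      using inj_onD[OF f(2)] bu bv' unfolding branch_def by auto
    then have bv: "branch v b" using bv' by simp
    \<comment> \<open>A path avoiding \<open>q\<close> lies in a single branch, so all its vertices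
      are reached from \<open>b\<close>, not just one.\<close>
    have linkb: "linked T ?Q b s" if "branch w b" "E w w'" "s \<in> set (P w)" for w w' s
    proof -
      obtain t where t: "t \<in> set (P w)" "linked T ?Q b t" using \<open>branch w b\<close> unfolding branch_def by blast
      have "linked T (set (P w)) t s"
        using sub[OF path[OF \<open>E w w'\<close>]] t that unfolding subtree_def by blast
      then have "linked T ?Q t s"
        using vne[OF path[OF \<open>E w w'\<close>]] qnot[OF \<open>E w w'\<close>] by (auto elim: linked_mono)
      then show ?thesis using t linked_trans by metis
    qed
    obtain k where k: "k \<in> K" "set (P k) \<inter> set (P u) \<noteq> {}" "set (P k) \<inter> set (P v) \<noteq> {}"
      using common[OF E] by blast
    obtain s t where s: "s \<in> set (P k)" "s \<in> set (P u)" and t: "t \<in> set (P k)" "t \<in> set (P v)"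
      using k by blast
    \<comment> \<open>If \<open>s\<close> on the path of \<open>y\<close> separated \<open>q\<close>
      from \<open>t\<close>, it would lie on the connection that runs from \<open>q\<close> along
      the path of \<open>l\<close> to the path of \<open>x\<close> and then to \<open>t\<close>. But
      neither of these two paths meets that of \<open>y\<close>.\<close>
    have blocked: False
      if E: "E x y" and t: "t \<in> set (P x)" and s: "s \<in> set (P y)"
        and mid: "\<And>S. linked T S q t \<Longrightarrow> s \<in> S" for x y s t
    proof -
      obtain l where l: "l \<in> K" "set (P l) \<inter> set (P x) \<noteq> {}" "set (P l) \<inter> set (P y) = {}"
        using own_nb[OF E] by blast
      then obtain d where d: "d \<in> set (P l)" "d \<in> set (P x)" by blast
      have "linked T (set (P l)) q d"
        using sub[OF K(2)[OF l(1)]] q[OF l(1)] d unfolding subtree_def by blast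
      moreover have "linked T (set (P x)) d t"
        using sub[OF path[OF E]] d t unfolding subtree_def by blast
      ultimately have "linked T (set (P l) \<union> set (P x)) q t"
        using linked_trans[of T "set (P l) \<union> set (P x)" q d t] by (metis linked_mono sup_ge1 sup_ge2)
      then have "s \<in> set (P l) \<union> set (P x)" using mid by blast
      then show False using l(3) s disj[OF E] by blast
    qed
    \<comment> \<open>The common branch connects \<open>s\<close> and \<open>t\<close> without
      \<open>q\<close>, so on the path of \<open>k\<close> the vertex \<open>q\<close> is not
      between them. Hence \<open>s\<close> or \<open>t\<close> is the middle one, and
      \<open>blocked\<close> applies.\<close>
    have "linked T ?Q s t"
      using linkb[OF bu E s(2)] linkb[OF bv Evu t(2)] linked_sym[OF tree_symmetric] linked_trans
      by metis
    from K(2)[OF k(1)] q[OF k(1)] s(1) t(1) show False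
    proof (cases rule: vpath_middle)
      case x
      then show False using \<open>linked T ?Q s t\<close> by blast
    next
      case y
      then show False using blocked[OF Evu t(2) s(2)] by blast
    next
      case z
      then show False using blocked[OF E s(2) t(2)] by blast
    qed
  qed
  show ?thesis using ch ne by blast
qed

end

section \<open>Trees given by a parent function\<close>

lemma pcas_nth:
  assumes "pcas u es v" "i < length es"
  shows "es ! i = (pawalk_verts u es ! i, pawalk_verts u es ! Suc i)"
  using assms
proof (induction es arbitrary: u i)
  case (Cons e es)
  show ?case
  proof (cases i)
    case 0
    then show ?thesis using Cons.prems by (cases es; cases e) auto
  qed (use Cons in auto)
qed simp

lemma pawalk_verts_ends:
  assumes "pcas u es v"
  shows "length (pawalk_verts u es) = Suc (length es)" "pawalk_verts u es ! 0 = u"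
    "pawalk_verts u es ! length es = v"
  using assms by (induction es arbitrary: u) auto

text \<open>Below, parents are assumed to be smaller than their children
  (\<open>parent_less\<close>). Then no cycle needs to be excluded by hand: a largest vertex of a
  cycle gives the contradiction.\<close>

definition parent_tree :: "nat \<Rightarrow> (nat \<Rightarrow> nat) \<Rightarrow> nat pair_pre_digraph" where
  "parent_tree N p = \<lparr> pverts = {..N},
     parcs = {(x, p x) | x. 0 < x \<and> x \<le> N} \<union> {(p x, x) | x. 0 < x \<and> x \<le> N} \<rparr>"

text \<open>The test \<open>p x < x\<close> only serves termination.\<close>

function root_path :: "(nat \<Rightarrow> nat) \<Rightarrow> nat \<Rightarrow> nat list" where
  "root_path p x = (if 0 < x \<and> p x < x then x # root_path p (p x) else [x])"
  by pat_completeness auto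
termination by (relation "measure snd") auto

declare root_path.simps [simp del]

lemma root_path_0 [simp]: "root_path p 0 = [0]"
  by (simp add: root_path.simps)

lemma hd_root_path [simp]: "hd (root_path p x) = x" "root_path p x \<noteq> []"
  by (subst root_path.simps, simp)+

context
  fixes N :: nat and p :: "nat \<Rightarrow> nat"
  assumes parent_less: "\<And>x. 0 < x \<Longrightarrow> x \<le> N \<Longrightarrow> p x < x"
begin

lemma parent_tree_pair_graph: "pair_graph (parent_tree N p)"
proof
  let ?T = "parent_tree N p"
  have p: "p x \<le> N \<and> p x \<noteq> x" if "0 < x" "x \<le> N" for x using parent_less[OF that] that by simp
  have sub: "parcs ?T \<subseteq> {..N} \<times> {..N}"
    using p by (auto simp: parent_tree_def)
  show "finite (pverts ?T)" by (simp add: parent_tree_def)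
  show "finite (parcs ?T)" using sub by (rule finite_subset) simp
  show "fst e \<in> pverts ?T" "snd e \<in> pverts ?T" if "e \<in> parcs ?T" for e
    using sub that unfolding parent_tree_def by auto
  show "fst e \<noteq> snd e" if e: "e \<in> parcs ?T" for e
  proof -
    obtain x where "0 < x" "x \<le> N" "e = (x, p x) \<or> e = (p x, x)"
      using e by (auto simp: parent_tree_def)
    then show ?thesis using p[of x] by auto
  qed
  show "symmetric (with_proj ?T)"
    unfolding symmetric_def sym_def by (auto simp: parent_tree_def)
qed

lemma root_path_parent: "0 < x \<Longrightarrow> x \<le> N \<Longrightarrow> root_path p x = x # root_path p (p x)"
  using parent_less by (subst root_path.simps) simp

lemma root_path_vpath:
  "x \<le> N \<Longrightarrow> vpath (root_path p x) (parent_tree N p) \<and> last (root_path p x) = 0 \<and>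
    set (root_path p x) \<subseteq> {..x}"
proof (induction x rule: less_induct)
  case (less x)
  show ?case
  proof (cases "x = 0")
    case True
    then show ?thesis by (auto simp: parent_tree_def intro: vpath_self)
  next
    case False
    then have px: "p x < x" "p x \<le> N" using parent_less[of x] less.prems by auto
    have eq: "root_path p x = x # root_path p (p x)" using root_path_parent less.prems False by simp
    note IH = less.IH[OF px]
    have "vwalk (root_path p x) (parent_tree N p)"
      unfolding eq using IH False less.prems
      by (intro vwalk_consI) (auto simp: parent_tree_def)
    then show ?thesis
      unfolding eq using IH px by (auto simp: vpath_def)
  qed
qed

text \<open>Both neighbours of the largest vertex \<open>m\<close> of a cycle are at most
  \<open>m\<close>, so both equal \<open>p m\<close>. On a cycle of length at least 3 they would be
  distinct.\<close>

lemma parent_tree_acyclic: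
  assumes "pre_digraph.cycle (parent_tree N p) es"
  shows "length es < 3"
proof (rule ccontr)
  assume "\<not> length es < 3"
  then have len: "length es \<ge> 3" by simp
  let ?T = "parent_tree N p"
  interpret pair_graph ?T by (rule parent_tree_pair_graph)
  obtain u where u: "awalk u es u" "distinct (tl (pawalk_verts u es))"
    using assms unfolding cycle_def by auto
  have cas: "pcas u es u" and es: "set es \<subseteq> parcs ?T" using u(1) by (auto simp: awalk_def)
  define vs where "vs = pawalk_verts u es"
  define n where "n = length es"
  have vs: "length vs = Suc n" "vs ! 0 = vs ! n" and n: "n \<ge> 3"
    using pawalk_verts_ends[OF cas] len by (auto simp: vs_def n_def)
  have arc: "(vs ! i, vs ! Suc i) \<in> parcs ?T" if "i < n" for i
    using pcas_nth[OF cas, of i] es that nth_mem[of i es] by (auto simp: vs_def n_def)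
  \<comment> \<open>A closed walk repeats its start as its end, so distinctness holds for the
    indices from 1 to \<open>n\<close> only.\<close>
  have inj: "i = j" if "vs ! i = vs ! j" "1 \<le> i" "i \<le> n" "1 \<le> j" "j \<le> n" for i j
  proof -
    have "tl vs ! (i - 1) = tl vs ! (j - 1)" "i - 1 < length (tl vs)" "j - 1 < length (tl vs)"
      using that vs by (auto simp: nth_tl)
    then show ?thesis using u(2) that unfolding vs_def[symmetric] by (metis nth_eq_iff_index_eq le_add_diff_inverse)
  qed
  have adj: "y = p x" if "(x, y) \<in> parcs ?T \<or> (y, x) \<in> parcs ?T" "y \<le> x" for x y
  proof -
    have "y = p x \<or> x = p y \<and> 0 < y \<and> y \<le> N" using that(1) by (auto simp: parent_tree_def)
    then show ?thesis using parent_less[of y] that(2) by auto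
  qed
  define m where "m = Max ((\<lambda>i. vs ! i) ` {1..n})"
  have "m \<in> (\<lambda>i. vs ! i) ` {1..n}" unfolding m_def using n by (intro Max_in) auto
  then obtain i where i: "1 \<le> i" "i \<le> n" "vs ! i = m" by auto
  have le: "vs ! j \<le> m" if "j \<le> n" for j
  proof -
    have "vs ! j \<le> m" if "1 \<le> j" "j \<le> n" for j unfolding m_def using that by (intro Max_ge) auto
    then show ?thesis using vs(2) that n by (cases "j = 0") auto
  qed
  \<comment> \<open>Successor \<open>a\<close> and predecessor \<open>b\<close> of \<open>i\<close>
    in the cyclic order of 1 to \<open>n\<close>.\<close>
  define a where "a = (if i = n then 1 else Suc i)"
  define b where "b = (if i = 1 then n else i - 1)"
  have "(vs ! i, vs ! a) \<in> parcs ?T"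
    using arc[of i] arc[of 0] i vs n unfolding a_def by auto
  moreover have "(vs ! b, vs ! i) \<in> parcs ?T"
    using arc[of "i - 1"] i vs n unfolding b_def by auto
  moreover have "a \<le> n" "b \<le> n" "1 \<le> a" "1 \<le> b" "a \<noteq> b" using i n by (auto simp: a_def b_def)
  ultimately have "vs ! a = p m" "vs ! b = p m" using adj le i(3) by metis+
  then show False using inj[of a b] \<open>a \<le> n\<close> \<open>b \<le> n\<close> \<open>1 \<le> a\<close> \<open>1 \<le> b\<close> \<open>a \<noteq> b\<close> by simp
qed

lemma parent_tree_tree: "undirected_tree (parent_tree N p)"
proof -
  let ?T = "parent_tree N p"
  interpret pair_graph ?T by (rule parent_tree_pair_graph)
  have root: "x \<rightarrow>\<^sup>*\<^bsub>?T\<^esub> 0" if "x \<in> pverts ?T" for x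
    using root_path_vpath[of x] that unfolding reachable_vwalk_conv
    by (intro exI[of _ "root_path p x"]) (auto simp: parent_tree_def vpath_def)
  have "x \<rightarrow>\<^sup>*\<^bsub>?T\<^esub> y" if "x \<in> pverts ?T" "y \<in> pverts ?T" for x y
    using root[OF that(1)] root[OF that(2)] symmetric_reachable[OF sym_arcs] reachable_trans by blast
  then have "strongly_connected ?T"
    by (intro strongly_connectedI) (auto simp: parent_tree_def)
  then have "connected ?T" 
    unfolding connected_def strongly_connected_def by (auto intro: reachable_mk_symmetricI)
  then show ?thesis
    unfolding undirected_tree_def using parent_tree_pair_graph parent_tree_acyclic
    by (meson not_less)
qed

text \<open>Walking from \<open>x\<close> to the root and back out to \<open>y\<close> repeats no
  vertex. This will be the path of a clique vertex with two stable neighbours.\<close>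

lemma parent_tree_vpath_through_root:
  assumes "x \<le> N" "y \<le> N" "set (root_path p x) \<inter> set (root_path p y) \<subseteq> {0}"
  shows "\<exists>w. vpath w (parent_tree N p) \<and> set w = set (root_path p x) \<union> set (root_path p y)"
proof -
  let ?T = "parent_tree N p" and ?x = "root_path p x" and ?y = "root_path p y"
  interpret pair_graph ?T by (rule parent_tree_pair_graph)
  have x: "vwalk ?x ?T" "distinct ?x" "last ?x = 0"
    and y: "vwalk ?y ?T" "distinct ?y" "last ?y = 0"
    using assms root_path_vpath by auto
  have ry: "vwalk (rev ?y) ?T"
  proof
    show "set (vwalk_arcs (rev ?y)) \<subseteq> arcs_ends ?T"
      using y(1) sym_arcs unfolding set_vwalk_arcs_rev symmetric_def sym_def vwalk_def by blast
  qed (use y in \<open>auto simp: vwalk_def\<close>)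
  \<comment> \<open>Joining drops the first vertex of the second walk, here the root, so that only
    \<open>butlast\<close> of the path of \<open>y\<close> is added.\<close>
  have rev: "rev ?y = 0 # rev (butlast ?y)"
    using y(3) by (metis append_butlast_last_id hd_root_path(2) rev.simps(2) rev_rev_ident rev_swap)
  have "0 \<notin> set (butlast ?y)"
    using y(2) rev by (metis distinct.simps(2) distinct_rev set_rev)
  moreover have sy: "set ?y = insert 0 (set (butlast ?y))"
    using rev by (metis list.simps(15) set_rev)
  ultimately have "distinct (?x \<oplus> rev ?y)"
    using x(2) y(2) assms(3) by (auto simp: vwalk_join_def rev distinct_butlast)
  moreover have "vwalk (?x \<oplus> rev ?y) ?T"
    by (rule vwalk_joinI_vwalk) (use x ry in \<open>auto simp: joinable_def hd_rev y(3)\<close>)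
  moreover have "set (?x \<oplus> rev ?y) = set ?x \<union> set ?y"
    using x(3) sy hd_root_path(2)[of p x] last_in_set[of ?x] by (auto simp: vwalk_join_def rev)
  ultimately show ?thesis by (intro exI[of _ "?x \<oplus> rev ?y"]) auto
qed

end

section \<open>Split graphs in the class \<open>[h,2,1]\<close>\<close>

text \<open>The host tree consists of a root \<open>0\<close> with \<open>h\<close> spines of length \<open>n\<close>, the spine of colour
  \<open>i\<close> being the residue class of \<open>Suc i\<close> modulo \<open>h\<close> in \<open>{1..h * n}\<close>, and one leaf
  \<open>h * n + 1 + k\<close> for each \<open>k < n\<close>, attached to the spine of colour \<open>c k\<close> at height \<open>k\<close>.\<close>

definition spine_parent :: "nat \<Rightarrow> nat \<Rightarrow> (nat \<Rightarrow> nat) \<Rightarrow> nat \<Rightarrow> nat" where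
  "spine_parent h n c x = (if x \<le> h * n then x - h
     else 1 + c (x - h * n - 1) + h * (x - h * n - 1))"

context
  fixes h n :: nat and c :: "nat \<Rightarrow> nat"
  assumes h: "h \<ge> 3" and c: "\<And>k. k < n \<Longrightarrow> c k < h"
begin

lemma spine_bound: "k < n \<Longrightarrow> 1 + c k + h * k \<le> h * n"
proof -
  assume k: "k < n"
  then have "Suc k \<le> n" by simp
  then have "h * Suc k \<le> h * n" by (rule mult_le_mono2)
  then show ?thesis using c[OF k] by simp
qed

lemma spine_parent_less:
  assumes "0 < x" "x \<le> h * n + n"
  shows "spine_parent h n c x < x"
proof (cases "x \<le> h * n")
  case True
  then show ?thesis using assms h by (simp add: spine_parent_def)
next
  case False
  then have "x - h * n - 1 < n" "h * n < x" using assms by auto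
  then show ?thesis using spine_bound[of "x - h * n - 1"] False by (simp add: spine_parent_def)
qed

abbreviation (input) "spine_tree \<equiv> parent_tree (h * n + n) (spine_parent h n c)"
abbreviation (input) "spine_path \<equiv> root_path (spine_parent h n c)"

lemma spine_tree_degree:
  assumes t: "t \<in> verts spine_tree"
  shows "out_degree spine_tree t \<le> h"
proof -
  let ?p = "spine_parent h n c"
  have h0: "0 < h" using h by simp
  \<comment> \<open>The root has the children 1 to \<open>h\<close>. Any other vertex has its
    parent, the next spine vertex and at most one leaf, whose index is recovered by division as
    \<open>(t - 1) div h\<close>; these are 3 neighbours at most, and \<open>h >= 3\<close>.\<close>
  define S where "S = (if t = 0 then {1..h} else {?p t, t + h, h * n + 1 + (t - 1) div h})"
  have "card S \<le> h"
  proof (cases "t = 0")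
    case False
    have "card {?p t, t + h, h * n + 1 + (t - 1) div h} \<le> 3"
      by (metis card_length length_Cons list.size(3) list.simps(15) empty_set numeral_3_eq_3)
    then show ?thesis using False h unfolding S_def by simp
  qed (simp add: S_def)
  moreover have fin: "finite S" unfolding S_def by simp
  moreover have "out_arcs spine_tree t \<subseteq> Pair t ` S"
  proof
    fix e assume e: "e \<in> out_arcs spine_tree t"
    then obtain y where y: "e = (t, y)" by (cases e) auto
    consider "y = ?p t" "0 < t" | "t = ?p y" "0 < y" "y \<le> h * n + n"
      using e y unfolding parent_tree_def by auto
    then have "y \<in> S"
    proof cases
      case 1
      then show ?thesis by (simp add: S_def)
    next
      case 2
      show ?thesis
      proof (cases "y \<le> h * n")
        case True
        then show ?thesis using 2 by (auto simp: S_def spine_parent_def)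
      next
        case False
        define k where "k = y - h * n - 1"
        have yk: "y = h * n + 1 + k" "k < n" using False 2 by (auto simp: k_def)
        then have "t = 1 + c k + h * k" using 2 by (simp add: spine_parent_def)
        then have "t \<noteq> 0" "(t - 1) div h = k" using c[OF yk(2)] h0 by simp_all
        then show ?thesis using yk by (simp add: S_def)
      qed
    qed
    then show "e \<in> Pair t ` S" using y by simp
  qed
  ultimately show ?thesis
    unfolding out_degree_def by (meson card_image_le card_mono finite_imageI le_trans)
qed

text \<open>Steps of length \<open>h\<close> preserve the residue of \<open>x - 1\<close>, which is
  the colour of the spine. The root is left out because it belongs to all spines.\<close>

lemma spine_path_spine:
  assumes "y \<in> set (spine_path x)" "y \<noteq> 0" "x \<le> h * n"
  shows "y \<le> h * n \<and> (y - 1) mod h = (x - 1) mod h"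
  using assms
proof (induction x rule: less_induct)
  case (less x)
  show ?case
  proof (cases "x = 0")
    case False
    then have eq: "spine_path x = x # spine_path (x - h)"
      using less.prems h by (subst root_path.simps) (simp add: spine_parent_def)
    show ?thesis
    proof (cases "y = x")
      case ne: False
      then have y: "y \<in> set (spine_path (x - h))" using less.prems eq by simp
      then have "x - h \<noteq> 0" using less.prems by (auto intro: ccontr)
      then have "(x - h - 1) mod h = (x - 1) mod h" by (simp add: le_mod_geq)
      then show ?thesis
        using less.IH[OF _ y] \<open>x - h \<noteq> 0\<close> less.prems h by simp
    qed (use less.prems in simp)
  qed (use less.prems in simp)
qed

lemma spine_path_leaf:
  assumes "k < n"
  shows "set (spine_path (h * n + 1 + k)) = insert (h * n + 1 + k) (set (spine_path (1 + c k + h * k)))"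
  using spine_bound[OF assms] by (subst root_path.simps) (simp add: spine_parent_def)

text \<open>This is what makes leaves of different colours have root paths that meet in the root
  only.\<close>

lemma spine_path_leaf_cases:
  assumes "k < n" "y \<in> set (spine_path (h * n + 1 + k))" "y \<noteq> 0"
  shows "y = h * n + 1 + k \<or> y \<le> h * n \<and> (y - 1) mod h = c k"
  using spine_path_spine[of y "1 + c k + h * k"] spine_path_leaf[OF assms(1)] spine_bound[OF assms(1)]
    c[OF assms(1)] assms by auto

lemma zero_in_spine_path: "x \<le> h * n + n \<Longrightarrow> 0 \<in> set (spine_path x)"
  using root_path_vpath[OF spine_parent_less] by (metis hd_root_path(2) last_in_set)

end

text \<open>A stable vertex is represented by a leaf of its own, a clique vertex by the union of the
  root paths of the leaves of its stable neighbours. There are at most two of these, of different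
  colours, so the union is a path through the root, where all clique paths meet.\<close>

lemma split_graph_in_h21:
  fixes G :: "('a, 'b) pre_digraph"
  assumes G: "graph G" and h: "h \<ge> 3"
    and verts: "verts G = K \<union> I" "K \<inter> I = {}"
    and clique: "\<And>x y. x \<in> K \<Longrightarrow> y \<in> K \<Longrightarrow> x \<noteq> y \<Longrightarrow> x \<rightarrow>\<^bsub>G\<^esub> y"
    and stable: "\<And>x y. x \<in> I \<Longrightarrow> y \<in> I \<Longrightarrow> \<not> x \<rightarrow>\<^bsub>G\<^esub> y"
    and two: "\<And>k. k \<in> K \<Longrightarrow> \<exists>u w. {x \<in> I. k \<rightarrow>\<^bsub>G\<^esub> x} \<subseteq> {u, w}"
    and col: "\<And>x. x \<in> I \<Longrightarrow> c x < h"
    and proper: "\<And>k x y. k \<in> K \<Longrightarrow> x \<in> I \<Longrightarrow> y \<in> I \<Longrightarrow> k \<rightarrow>\<^bsub>G\<^esub> x \<Longrightarrow> k \<rightarrow>\<^bsub>G\<^esub> y \<Longrightarrow> x \<noteq> y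
      \<Longrightarrow> c x \<noteq> c y"
  shows "in_h21 h G"
proof -
  interpret graph G by fact
  have "finite I" using verts finite_verts by simp
  then obtain idx where idx: "bij_betw idx I {0..<card I}"
    using ex_bij_betw_finite_nat by blast
  define n where "n = card I"
  have idx_n: "idx x < n" if "x \<in> I" for x using idx that by (auto simp: n_def bij_betw_def)
  have idx_inj: "x = y" if "idx x = idx y" "x \<in> I" "y \<in> I" for x y
    using idx that by (auto simp: bij_betw_def dest: inj_onD)
  \<comment> \<open>The spine tree colours indices, so the colouring is transported along
    \<open>idx\<close>.\<close>
  define cc where "cc k = c (inv_into I idx k)" for k
  have cc_idx: "cc (idx x) = c x" if "x \<in> I" for x
    unfolding cc_def using idx that by (simp add: bij_betw_def inv_into_f_f)
  have cc: "cc k < h" if "k < n" for k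
  proof -
    have "inv_into I idx k \<in> I"
      using idx that inv_into_into[of k idx I] by (simp add: bij_betw_def n_def)
    then show ?thesis unfolding cc_def by (rule col)
  qed
  note less = spine_parent_less[of h n cc, OF h cc]
  let ?p = "spine_parent h n cc" and ?N = "h * n + n"
  let ?T = "parent_tree ?N ?p"
  define L where "L x = h * n + 1 + idx x" for x
  have LN: "L x \<le> ?N" "L x \<noteq> 0" "h * n < L x" if "x \<in> I" for x using idx_n[OF that] by (auto simp: L_def)
  have L_inj: "x = y" if "L x = L y" "x \<in> I" "y \<in> I" for x y
    using that idx_inj by (simp add: L_def)
  define up where "up x = set (root_path ?p (L x))" for x
  have up_cases: "y = L x \<or> y \<le> h * n \<and> (y - 1) mod h = c x" if "y \<in> up x" "y \<noteq> 0" "x \<in> I" for x y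
    using spine_path_leaf_cases[of h n cc "idx x" y, OF h cc idx_n[OF that(3)]] that cc_idx unfolding up_def L_def by simp
  have up_L: "L x \<in> up x" for x unfolding up_def by (metis hd_in_set hd_root_path)
  have L_up: "L y \<in> up x \<longleftrightarrow> y = x" if "x \<in> I" "y \<in> I" for x y
    using up_cases[of "L y" x] up_L L_inj LN that by fastforce
  have up_disj: "up x \<inter> up y \<subseteq> {0}" if "x \<in> I" "y \<in> I" "c x \<noteq> c y" for x y
    using up_cases[OF _ _ that(1)] up_cases[OF _ _ that(2)] L_inj that LN by fastforce
  \<comment> \<open>The root is inserted for clique vertices without stable neighbours, whose path
    is the root alone.\<close>
  have ex: "\<exists>w. vpath w ?T \<and> set w = insert 0 (\<Union>(up ` {x \<in> I. k \<rightarrow>\<^bsub>G\<^esub> x}))" if k: "k \<in> K" for k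
  proof -
    let ?X = "{x \<in> I. k \<rightarrow>\<^bsub>G\<^esub> x}"
    have zero: "0 \<in> up x" if "x \<in> I" for x
      unfolding up_def using zero_in_spine_path[of h n cc "L x", OF h cc LN(1)[OF that]] by blast
    obtain u w where uw: "?X \<subseteq> {u, w}" using two[OF k] by blast
    have "\<exists>x y. x \<in> ?X \<and> y \<in> ?X \<and> x \<noteq> y \<and> ?X = {x, y} \<or> x \<in> ?X \<and> ?X = {x} \<or> ?X = {}"
      using uw by blast
    then consider "?X = {}" | x where "x \<in> ?X" "?X = {x}"
      | x y where "x \<in> ?X" "y \<in> ?X" "x \<noteq> y" "?X = {x, y}"
      by blast
    then show ?thesis
    proof cases
      case 1
      then show ?thesis
        by (intro exI[of _ "[0]"]) (auto simp: parent_tree_def intro: vpath_self)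
    next
      case (2 x)
      then show ?thesis
        using root_path_vpath[of ?N ?p "L x", OF less] LN[of x] zero[of x]
        by (intro exI[of _ "root_path ?p (L x)"]) (auto simp: up_def)
    next
      case (3 x y)
      then have "c x \<noteq> c y" using proper[OF k] by blast
      then have "up x \<inter> up y \<subseteq> {0}" using up_disj 3 by blast
      then obtain w where "vpath w ?T" "set w = up x \<union> up y"
        using parent_tree_vpath_through_root[of ?N ?p "L x" "L y", OF less] LN[of x] LN[of y] 3
        unfolding up_def by auto
      then show ?thesis using 3 zero[of x] by (intro exI[of _ w]) auto
    qed
  qed
  define Q where "Q k = (SOME w. vpath w ?T \<and> set w = insert 0 (\<Union>(up ` {x \<in> I. k \<rightarrow>\<^bsub>G\<^esub> x})))" for k
  have Q: "vpath (Q k) ?T" "set (Q k) = insert 0 (\<Union>(up ` {x \<in> I. k \<rightarrow>\<^bsub>G\<^esub> x}))" if "k \<in> K" for k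
    using someI_ex[OF ex[OF that]] unfolding Q_def by auto
  define P where "P x = (if x \<in> I then [L x] else Q x)" for x
  have PI: "P x = [L x]" if "x \<in> I" for x using that by (simp add: P_def)
  have PK: "P x = Q x" if "x \<in> K" for x using that verts(2) by (auto simp: P_def)
  \<comment> \<open>The leaf of \<open>x\<close> lies on no root path of another leaf, so the path
    of \<open>k\<close> contains it only if \<open>x\<close> is a neighbour of
    \<open>k\<close>.\<close>
  have mixed: "set (P x) \<inter> set (P k) \<noteq> {} \<longleftrightarrow> k \<rightarrow>\<^bsub>G\<^esub> x" if "x \<in> I" "k \<in> K" for x k
    using L_up that LN(2)[of x] by (auto simp: PI PK Q(2))
  have symm: "x \<rightarrow>\<^bsub>G\<^esub> y \<longleftrightarrow> y \<rightarrow>\<^bsub>G\<^esub> x" for x y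
    using sym_arcs unfolding symmetric_def sym_def by blast
  have adj: "x \<rightarrow>\<^bsub>G\<^esub> y \<longleftrightarrow> set (P x) \<inter> set (P y) \<noteq> {}"
    if xy: "x \<in> verts G" "y \<in> verts G" "x \<noteq> y" for x y
  proof -
    consider "x \<in> I" "y \<in> I" | "x \<in> I" "y \<in> K" | "x \<in> K" "y \<in> I" | "x \<in> K" "y \<in> K"
      using xy(1,2) unfolding verts(1) by blast
    then show ?thesis
    proof cases
      case 1
      then show ?thesis using stable[of x y] L_inj[of x y] xy by (auto simp: PI)
    next
      case 2
      then show ?thesis using mixed[of x y] symm[of x y] by simp
    next
      case 3
      then show ?thesis using mixed[of y x] by (simp add: Int_commute)
    next
      case 4
      then show ?thesis using clique[of x y] xy PK Q(2) by simp
    qed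
  qed
  have "VPT_representation ?T P G"
    unfolding VPT_representation_def
  proof (intro conjI ballI impI)
    show "undirected_tree ?T" using parent_tree_tree[of ?N ?p, OF less] .
    show "vpath (P x) ?T" if "x \<in> verts G" for x
    proof (cases "x \<in> I")
      case True
      then have "L x \<in> verts ?T" using LN(1) by (simp add: parent_tree_def)
      then show ?thesis unfolding PI[OF True] by (rule vpath_self)
    next
      case False
      then have "x \<in> K" using that verts by blast
      then show ?thesis using Q(1) PK by simp
    qed
    show "x \<rightarrow>\<^bsub>G\<^esub> y \<longleftrightarrow> set (P x) \<inter> set (P y) \<noteq> {}" if "x \<in> verts G" "y \<in> verts G" "x \<noteq> y" for x y
      using adj[OF that] .
  qed
  moreover have "\<forall>t \<in> verts ?T. out_degree ?T t \<le> h"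
    using spine_tree_degree[of h n cc, OF h cc] by simp
  ultimately show ?thesis
    unfolding in_h21_def using G by blast
qed

section \<open>Colourings\<close>

lemma dominates_del_vert [simp]:
  "u \<rightarrow>\<^bsub>pre_digraph.del_vert G x\<^esub> v \<longleftrightarrow> u \<rightarrow>\<^bsub>G\<^esub> v \<and> u \<noteq> x \<and> v \<noteq> x"
  by (auto simp: arcs_ends_def pre_digraph.del_vert_def arc_to_ends_def)

lemma dominates_del_edge [simp]:
  "u \<rightarrow>\<^bsub>del_edge G x y\<^esub> v \<longleftrightarrow> u \<rightarrow>\<^bsub>G\<^esub> v \<and> {u, v} \<noteq> {x, y}"
  by (auto simp: arcs_ends_def del_edge_def arc_to_ends_def doubleton_eq_iff)

lemma verts_del_vert_eq [simp]: "verts (pre_digraph.del_vert G x) = verts G - {x}"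
  by (simp add: pre_digraph.del_vert_def)

lemma verts_del_edge [simp]: "verts (del_edge G x y) = verts G"
  by (simp add: del_edge_def)

lemma graph_del_vert: "graph G \<Longrightarrow> graph (pre_digraph.del_vert G x)"
proof -
  assume "graph G"
  then interpret graph G .
  interpret D: fin_digraph "del_vert x" by (rule fin_digraph_del_vert)
  show ?thesis
  proof
    show "symmetric (del_vert x)"
      using sym_arcs unfolding symmetric_def sym_def by simp
  qed (auto simp: del_vert_simps no_loops ends_del_vert intro: no_multi_arcs)
qed

lemma colorable_mono: "colorable k G \<Longrightarrow> k \<le> m \<Longrightarrow> colorable m G"
  unfolding colorable_def by (meson less_le_trans)

text \<open>The hypothesis, for an arbitrary \<open>k\<close>, guarantees that the minimum defining
  \<open>chromatic_number\<close> is attained.\<close>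

lemma chromatic_number_le_iff:
  assumes "colorable k G"
  shows "chromatic_number G \<le> m \<longleftrightarrow> colorable m G"
  unfolding chromatic_number_def
  using assms colorable_mono LeastI[of "\<lambda>k. colorable k G"] Least_le[of "\<lambda>k. colorable k G"] by metis

lemma colorable_del:
  assumes "colorable k G"
  shows "colorable k (pre_digraph.del_vert G x)" "colorable k (del_edge G x y)"
  using assms unfolding colorable_def by auto

lemma GH_cliqueE:
  assumes "k \<in> GH_clique H"
  obtains (EdgeV) u v where "k = EdgeV {u, v}" "(u, v) \<in> parcs H"
  | (Tilde) v where "k = Tilde v" "v \<in> pverts H" "out_degree H v = 1"
  using assms unfolding GH_clique_def by auto

context
  fixes H :: "'a pair_pre_digraph"
  assumes H: "pair_graph H"
begin

lemma pair_graph_colorable: "\<exists>k. colorable k H"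
proof -
  interpret pair_graph H by (rule H)
  obtain f :: "'a \<Rightarrow> nat" and n where "f ` pverts H = {i. i < n}" "inj_on f (pverts H)"
    using finite_imp_inj_to_nat_seg[OF pair_finite_verts] by auto
  then have "colorable n H"
    unfolding colorable_def
    by (intro exI[of _ f]) (auto dest: no_loops' in_arcsD1 in_arcsD2 inj_onD)
  then show ?thesis ..
qed

lemma out_degree_conv: "out_degree H v = card {w. (v, w) \<in> parcs H}"
proof -
  have "out_arcs H v = Pair v ` {w. (v, w) \<in> parcs H}" by auto
  then show ?thesis unfolding out_degree_def by (simp add: card_image inj_on_def)
qed

lemma finite_nbs: "finite {w. (v, w) \<in> parcs H}"
proof -
  interpret pair_graph H by (rule H)
  show ?thesis
    by (rule finite_subset[OF _ pair_finite_verts]) (auto dest: in_arcsD2)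
qed

lemma nb_sym: "(u, v) \<in> parcs H \<Longrightarrow> (v, u) \<in> parcs H"
  using pair_sym_digraph.arcs_symmetric[of H] H
  by (meson pair_graph.axioms pair_pseudo_graph.axioms)

lemma nb_irrefl: "(u, u) \<notin> parcs H"
proof -
  interpret pair_graph H by (rule H)
  show ?thesis using no_loops' by blast
qed

lemma nb_verts: "(u, v) \<in> parcs H \<Longrightarrow> u \<in> pverts H \<and> v \<in> pverts H"
proof -
  interpret pair_graph H by (rule H)
  show "(u, v) \<in> parcs H \<Longrightarrow> u \<in> pverts H \<and> v \<in> pverts H" using in_arcsD1 in_arcsD2 by blast
qed

text \<open>Colours \<open>b\<close> with \<open>m\<close>. It is used with the new colour
  \<open>m = k\<close> and \<open>n = Suc k\<close>, and with \<open>n = k\<close> and an old colour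
  missing at the neighbours of \<open>b\<close>.\<close>

lemma colorable_extend:
  assumes "colorable k (pre_digraph.del_vert H b)"
    and "m < n" "k \<le> n" "m \<notin> c ` {w. (b, w) \<in> parcs H}"
    and c: "\<And>v. v \<in> pverts H \<Longrightarrow> v \<noteq> b \<Longrightarrow> c v < k"
      "\<And>u v. (u, v) \<in> parcs H \<Longrightarrow> u \<noteq> b \<Longrightarrow> v \<noteq> b \<Longrightarrow> c u \<noteq> c v"
  shows "colorable n H"
  unfolding colorable_def
proof (intro exI conjI ballI allI impI)
  let ?c = "c(b := m)"
  show "?c v < n" if "v \<in> verts H" for v using assms that by (auto intro: less_le_trans)
  show "?c u \<noteq> ?c v" if "u \<rightarrow>\<^bsub>H\<^esub> v" for u v
    using assms(4) c(2)[of u v] nb_irrefl[of b] nb_sym[of u v] that by auto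
qed

lemma del_vert_coloring:
  assumes "colorable k (pre_digraph.del_vert H b)"
  obtains c where "\<And>v. v \<in> pverts H \<Longrightarrow> v \<noteq> b \<Longrightarrow> c v < k"
    "\<And>u v. (u, v) \<in> parcs H \<Longrightarrow> u \<noteq> b \<Longrightarrow> v \<noteq> b \<Longrightarrow> c u \<noteq> c v"
  using assms unfolding colorable_def by auto

lemma colorable_Suc_del_vert:
  assumes "colorable k (pre_digraph.del_vert H b)"
  shows "colorable (Suc k) H"
proof -
  obtain c where c: "\<And>v. v \<in> pverts H \<Longrightarrow> v \<noteq> b \<Longrightarrow> c v < k"
    "\<And>u v. (u, v) \<in> parcs H \<Longrightarrow> u \<noteq> b \<Longrightarrow> v \<noteq> b \<Longrightarrow> c u \<noteq> c v"
    by (rule del_vert_coloring[OF assms]) blast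
  have "c w < k" if "(b, w) \<in> parcs H" for w
    using c(1)[of w] nb_verts[OF that] nb_irrefl that by auto
  then have "k \<notin> c ` {w. (b, w) \<in> parcs H}" by auto
  then show ?thesis using colorable_extend[OF assms, of k "Suc k" c] c by simp
qed

text \<open>Fewer than \<open>k\<close> neighbours leave one of the \<open>k\<close> colours free
  for \<open>b\<close>.\<close>

lemma colorable_del_vert_low_degree:
  assumes "colorable k (pre_digraph.del_vert H b)" "out_degree H b < k"
  shows "colorable k H"
proof -
  obtain c where c: "\<And>v. v \<in> pverts H \<Longrightarrow> v \<noteq> b \<Longrightarrow> c v < k"
    "\<And>u v. (u, v) \<in> parcs H \<Longrightarrow> u \<noteq> b \<Longrightarrow> v \<noteq> b \<Longrightarrow> c u \<noteq> c v"
    by (rule del_vert_coloring[OF assms(1)]) blast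
  let ?C = "c ` {w. (b, w) \<in> parcs H}"
  have "card ?C < card {..<k}"
    using assms(2) card_image_le[OF finite_nbs, of c b] unfolding out_degree_conv by simp
  then have "\<not> {..<k} \<subseteq> ?C"
    using finite_nbs[of b] by (meson card_mono finite_imageI not_le)
  then obtain m where "m < k" "m \<notin> ?C" by auto
  then show ?thesis using colorable_extend[OF assms(1), of m k c] c by simp
qed

section \<open>The graph \<open>G_H\<close> and its induced subgraphs\<close>

lemma GH_finite: "finite (GH_clique H)" "finite (pverts H)"
proof -
  interpret pair_graph H by (rule H)
  show fin: "finite (pverts H)" by (rule pair_finite_verts)
  have "GH_clique H \<subseteq> EdgeV ` Pow (pverts H) \<union> Tilde ` pverts H"
    unfolding GH_clique_def using nb_verts by auto
  then show "finite (GH_clique H)" using fin by (meson finite_Pow_iff finite_UnI finite_imageI finite_subset)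
qed

lemma GH_cross_subset: "GH_cross H \<subseteq> Orig ` pverts H \<times> GH_clique H"
  unfolding GH_cross_def GH_clique_def using nb_verts by auto

lemma Orig_notin_clique [simp]: "Orig v \<notin> GH_clique H"
  by (auto simp: GH_clique_def)

lemma GH_arcs:
  "k \<in> GH_clique H \<Longrightarrow> l \<in> GH_clique H \<Longrightarrow> (k, l) \<in> parcs (GH H) \<longleftrightarrow> k \<noteq> l"
  "(Orig u, Orig v) \<notin> parcs (GH H)"
  "k \<in> GH_clique H \<Longrightarrow> (k, Orig v) \<in> parcs (GH H) \<longleftrightarrow> (Orig v, k) \<in> GH_cross H"
  "k \<in> GH_clique H \<Longrightarrow> (Orig v, k) \<in> parcs (GH H) \<longleftrightarrow> (Orig v, k) \<in> GH_cross H"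
  using GH_cross_subset by (auto simp: GH_def)

lemma GH_cross_EdgeV [simp]:
  "(Orig x, EdgeV {u, v}) \<in> GH_cross H \<longleftrightarrow> (u, v) \<in> parcs H \<and> x \<in> {u, v}"
  unfolding GH_cross_def using nb_sym by (auto simp: doubleton_eq_iff)

lemma GH_cross_Tilde [simp]:
  "(Orig x, Tilde v) \<in> GH_cross H \<longleftrightarrow> x = v \<and> v \<in> pverts H \<and> out_degree H v = 1"
  unfolding GH_cross_def by auto

lemma EdgeV_in_clique [simp]: "EdgeV {u, v} \<in> GH_clique H \<longleftrightarrow> (u, v) \<in> parcs H"
  unfolding GH_clique_def using nb_sym by (auto simp: doubleton_eq_iff)

lemma GH_graph: "graph (GH H)"
proof -
  have sub: "parcs (GH H) \<subseteq> pverts (GH H) \<times> pverts (GH H)"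
    using GH_cross_subset by (auto simp: GH_def)
  have fin: "finite (pverts (GH H))" using GH_finite by (simp add: GH_def)
  have "pair_graph (GH H)"
  proof
    show "finite (pverts (GH H))" by (rule fin)
    show "finite (parcs (GH H))" using finite_subset[OF sub] fin by simp
    show "fst e \<in> pverts (GH H)" "snd e \<in> pverts (GH H)" if "e \<in> parcs (GH H)" for e
      using sub that by auto
    show "fst e \<noteq> snd e" if "e \<in> parcs (GH H)" for e
      using that GH_cross_subset Orig_notin_clique by (fastforce simp: GH_def)
    show "symmetric (with_proj (GH H))"
      unfolding symmetric_def sym_def by (auto simp: GH_def)
  qed
  then show ?thesis by (rule pair_graph.pair_graphD_graph)
qed

end

text \<open>Allows \<open>GH H\<close> itself and its vertex-deleted subgraphs to be treated by the
  same two lemmas.\<close>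

definition induced_in :: "('a, 'b) pre_digraph \<Rightarrow> ('a, 'c) pre_digraph \<Rightarrow> bool" where
  "induced_in G G' \<longleftrightarrow> verts G \<subseteq> verts G' \<and>
     (\<forall>x\<in>verts G. \<forall>y\<in>verts G. x \<rightarrow>\<^bsub>G\<^esub> y \<longleftrightarrow> x \<rightarrow>\<^bsub>G'\<^esub> y)"

lemma induced_in_refl: "induced_in G G"
  by (simp add: induced_in_def)

lemma induced_in_del_vert: "induced_in (pre_digraph.del_vert G x) G"
  by (auto simp: induced_in_def verts_del_vert_eq)

section \<open>From colourings to host trees and back, for induced subgraphs of
  \<open>GH H\<close>\<close>

context
  fixes H :: "'a pair_pre_digraph" and G :: "('a GH_vertex, 'b) pre_digraph" and h :: nat
  assumes H: "pair_graph H" and ind: "induced_in G (GH H)"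
begin

lemma GH_induced_arc:
  "x \<in> verts G \<Longrightarrow> y \<in> verts G \<Longrightarrow> x \<rightarrow>\<^bsub>G\<^esub> y \<longleftrightarrow> (x, y) \<in> parcs (GH H)"
  using ind unfolding induced_in_def by simp

text \<open>Only edge vertices have two stable neighbours, so an edge of \<open>H\<close> constrains
  the colouring only if its edge vertex and both its ends survive in \<open>G\<close>.\<close>

lemma GH_induced_in_h21:
  assumes "graph G" "h \<ge> 3"
    and col: "\<And>v. Orig v \<in> verts G \<Longrightarrow> c v < h"
    and proper: "\<And>u v. (u, v) \<in> parcs H \<Longrightarrow> Orig u \<in> verts G \<Longrightarrow> Orig v \<in> verts G \<Longrightarrow>
      EdgeV {u, v} \<in> verts G \<Longrightarrow> c u \<noteq> c v"
  shows "in_h21 h G"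
proof (rule split_graph_in_h21[of G h "GH_clique H \<inter> verts G" "range Orig \<inter> verts G"
      "\<lambda>x. c (the_inv Orig x)"])
  have inv: "the_inv Orig (Orig v) = v" for v :: 'a by (simp add: the_inv_f_f inj_def)
  note arc = GH_induced_arc GH_arcs[OF H]
  show "verts G = (GH_clique H \<inter> verts G) \<union> (range Orig \<inter> verts G)"
    using ind by (auto simp: induced_in_def GH_def)
  show "GH_clique H \<inter> verts G \<inter> (range Orig \<inter> verts G) = {}"
    using Orig_notin_clique[OF H] by blast
  show "x \<rightarrow>\<^bsub>G\<^esub> y" if "x \<in> GH_clique H \<inter> verts G" "y \<in> GH_clique H \<inter> verts G" "x \<noteq> y" for x y
    using that by (simp add: arc)
  show "\<not> x \<rightarrow>\<^bsub>G\<^esub> y" if "x \<in> range Orig \<inter> verts G" "y \<in> range Orig \<inter> verts G" for x y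
    using that by (auto simp: arc)
  have nb: "x \<in> range Orig \<inter> verts G \<and> k \<rightarrow>\<^bsub>G\<^esub> x \<longleftrightarrow> x \<in> verts G \<and> (\<exists>v. x = Orig v \<and> (x, k) \<in> GH_cross H)"
    if "k \<in> GH_clique H \<inter> verts G" for x k
    using that by (auto simp: arc)
  show "\<exists>u w. {x \<in> range Orig \<inter> verts G. k \<rightarrow>\<^bsub>G\<^esub> x} \<subseteq> {u, w}" if k: "k \<in> GH_clique H \<inter> verts G" for k
    unfolding nb[OF k]
  proof -
    have "k \<in> GH_clique H" using k by simp
    then show "\<exists>u w. {x \<in> verts G. \<exists>v. x = Orig v \<and> (x, k) \<in> GH_cross H} \<subseteq> {u, w}"
    proof (cases rule: GH_cliqueE)
      case (EdgeV u v)
      then show ?thesis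
        by (intro exI[of _ "Orig u"] exI[of _ "Orig v"]) (auto simp: GH_cross_EdgeV[OF H])
    next
      case (Tilde v)
      then show ?thesis
        by (intro exI[of _ "Orig v"]) (auto simp: GH_cross_Tilde[OF H])
    qed
  qed
  show "c (the_inv Orig x) < h" if "x \<in> range Orig \<inter> verts G" for x
    using that col by (auto simp: inv)
  show "c (the_inv Orig x) \<noteq> c (the_inv Orig y)"
    if k: "k \<in> GH_clique H \<inter> verts G" and x: "x \<in> range Orig \<inter> verts G" "k \<rightarrow>\<^bsub>G\<^esub> x"
      and y: "y \<in> range Orig \<inter> verts G" "k \<rightarrow>\<^bsub>G\<^esub> y" and "x \<noteq> y" for k x y
  proof -
    obtain a b where ab: "x = Orig a" "y = Orig b" "a \<noteq> b" using x y \<open>x \<noteq> y\<close> by blast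
    have cr: "(Orig a, k) \<in> GH_cross H" "(Orig b, k) \<in> GH_cross H"
      using nb[OF k, of x] nb[OF k, of y] x y ab by auto
    have "k \<in> GH_clique H" using k by simp
    then show ?thesis
    proof (cases rule: GH_cliqueE)
      case (EdgeV u v)
      then have "{u, v} = {a, b}" using cr ab(3) by (auto simp: GH_cross_EdgeV[OF H])
      then have "EdgeV {a, b} \<in> verts G" "(a, b) \<in> parcs H"
        using k EdgeV EdgeV_in_clique[OF H, of a b] by auto
      then show ?thesis using proper[of a b] x y ab by (auto simp: inv)
    next
      case (Tilde v)
      then show ?thesis using cr ab(3) by (auto simp: GH_cross_Tilde[OF H])
    qed
  qed
qed (use assms in auto)

text \<open>\<open>E\<close> is a parameter because the surviving edges depend on the vertex deleted
  from \<open>GH H\<close>. The assumption \<open>own_nb\<close> is left to each application, since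
  a deletion may remove the clique vertex that would provide it.\<close>

lemma GH_induced_coloring:
  assumes G: "in_h21 h G" and "0 < h"
    and sym: "\<And>u v. E u v \<Longrightarrow> E v u"
    and E: "\<And>u v. E u v \<Longrightarrow> (u, v) \<in> parcs H \<and> Orig u \<in> verts G \<and> Orig v \<in> verts G \<and>
      EdgeV {u, v} \<in> verts G"
    and own_nb: "\<And>u v. E u v \<Longrightarrow> \<exists>k\<in>GH_clique H \<inter> verts G.
      (Orig u, k) \<in> GH_cross H \<and> (Orig v, k) \<notin> GH_cross H"
  shows "\<exists>c. (\<forall>v. c v < h) \<and> (\<forall>u v. E u v \<longrightarrow> c u \<noteq> c v)"
proof -
  let ?K = "GH_clique H \<inter> verts G"
  note arc = GH_induced_arc GH_arcs[OF H]
  interpret graph G using G by (simp add: in_h21_def)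
  obtain T :: "nat pair_pre_digraph" and P where rep: "VPT_representation T P G"
    and deg: "\<And>t. t \<in> verts T \<Longrightarrow> out_degree T t \<le> h"
    using G unfolding in_h21_def by blast
  have tree: "undirected_tree T" and path: "\<And>x. x \<in> verts G \<Longrightarrow> vpath (P x) T"
    and meet: "\<And>x y. x \<in> verts G \<Longrightarrow> y \<in> verts G \<Longrightarrow> x \<noteq> y \<Longrightarrow>
      set (P x) \<inter> set (P y) \<noteq> {} \<longleftrightarrow> (x, y) \<in> parcs (GH H)"
    using rep unfolding VPT_representation_def by (auto simp: GH_induced_arc)
  have cross: "set (P k) \<inter> set (P (Orig u)) \<noteq> {} \<longleftrightarrow> (Orig u, k) \<in> GH_cross H"
    if "k \<in> ?K" "Orig u \<in> verts G" for k u
    using that meet[of k "Orig u"] Orig_notin_clique[OF H, of u] by (auto simp: GH_arcs[OF H])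
  \<comment> \<open>\<open>branch_coloring\<close> colours vertices of \<open>G\<close>, so the
    relation is moved to the original vertices in \<open>G\<close>.\<close>
  define E' where "E' x y \<longleftrightarrow> (\<exists>u v. x = Orig u \<and> y = Orig v \<and> E u v)" for x y
  have "\<exists>c. (\<forall>x. c x < h) \<and> (\<forall>x y. E' x y \<longrightarrow> c x \<noteq> c y)"
  proof (rule branch_coloring[OF tree deg \<open>0 < h\<close>, of ?K P])
    show "finite ?K" by simp
    show "vpath (P k) T" if "k \<in> ?K" for k using that path by simp
    show "set (P k) \<inter> set (P l) \<noteq> {}" if "k \<in> ?K" "l \<in> ?K" for k l
    proof (cases "k = l")
      case True
      then show ?thesis using path[of k] that by auto
    next
      case False
      then show ?thesis using meet[of k l] that by (simp add: GH_arcs[OF H])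
    qed
    show "E' y x" if "E' x y" for x y using that sym unfolding E'_def by blast
    show "vpath (P x) T" if "E' x y" for x y using that E path unfolding E'_def by blast
    show "set (P x) \<inter> set (P y) = {}" if xy: "E' x y" for x y
    proof -
      obtain u v where uv: "x = Orig u" "y = Orig v" "E u v" using xy unfolding E'_def by blast
      then have "u \<noteq> v" using E[of u v] nb_irrefl[OF H] by auto
      then show ?thesis using meet[of x y] E[of u v] uv GH_arcs(2)[OF H] by blast
    qed
    show "\<exists>k\<in>?K. set (P k) \<inter> set (P x) \<noteq> {} \<and> set (P k) \<inter> set (P y) \<noteq> {}" if xy: "E' x y" for x y
    proof -
      obtain u v where uv: "x = Orig u" "y = Orig v" "E u v" using xy unfolding E'_def by blast
      then show ?thesis
        using E[of u v] cross[of "EdgeV {u, v}" u] cross[of "EdgeV {u, v}" v]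
        by (intro bexI[of _ "EdgeV {u, v}"]) (auto simp: GH_cross_EdgeV[OF H] EdgeV_in_clique[OF H])
    qed
    show "\<exists>k\<in>?K. set (P k) \<inter> set (P x) \<noteq> {} \<and> set (P k) \<inter> set (P y) = {}" if xy: "E' x y" for x y
    proof -
      obtain u v where uv: "x = Orig u" "y = Orig v" "E u v" using xy unfolding E'_def by blast
      obtain k where "k \<in> ?K" "(Orig u, k) \<in> GH_cross H" "(Orig v, k) \<notin> GH_cross H"
        using own_nb[OF uv(3)] by blast
      then show ?thesis using cross[of k u] cross[of k v] E[OF uv(3)] uv by blast
    qed
  qed
  then obtain c where c: "\<forall>x. c x < h" "\<forall>x y. E' x y \<longrightarrow> c x \<noteq> c y" by blast
  show ?thesis
    using c by (intro exI[of _ "\<lambda>v. c (Orig v)"]) (auto simp: E'_def)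
qed

end

section \<open>Deletions in \<open>GH H\<close> against colourability of \<open>H\<close> and its
  deletions\<close>

context
  fixes H :: "'a pair_pre_digraph" and h :: nat
  assumes H: "pair_graph H" and h: "h \<ge> 3"
begin

text \<open>This is the purpose of the \<open>Tilde\<close> vertices: if \<open>v\<close> is the
  only neighbour of \<open>u\<close>, the one edge vertex at \<open>u\<close> is also adjacent to
  \<open>v\<close>, and \<open>Tilde u\<close> takes over. Otherwise a second neighbour of
  \<open>u\<close> gives an edge vertex.\<close>

lemma GH_own_nb:
  assumes "(u, v) \<in> parcs H"
  shows "\<exists>k\<in>GH_clique H. (Orig u, k) \<in> GH_cross H \<and> (Orig v, k) \<notin> GH_cross H"
proof (cases "out_degree H u = 1")
  case True
  have "u \<in> pverts H" "u \<noteq> v" using assms nb_verts[OF H] nb_irrefl[OF H] by auto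
  then show ?thesis
    using True by (intro bexI[of _ "Tilde u"]) (auto simp: GH_cross_Tilde[OF H] GH_clique_def)
next
  case False
  have "\<exists>w. (u, w) \<in> parcs H \<and> w \<noteq> v"
  proof (rule ccontr)
    assume "\<nexists>w. (u, w) \<in> parcs H \<and> w \<noteq> v"
    then have "{w. (u, w) \<in> parcs H} = {v}" using assms by blast
    then show False using False out_degree_conv[OF H, of u] by simp
  qed
  then obtain w where w: "(u, w) \<in> parcs H" "w \<noteq> v" by blast
  have "u \<noteq> v" using assms nb_irrefl[OF H] by auto
  then show ?thesis
    using w by (intro bexI[of _ "EdgeV {u, w}"]) (auto simp: GH_cross_EdgeV[OF H] EdgeV_in_clique[OF H])
qed

lemma EdgeV_in_GH: "(u, v) \<in> parcs H \<Longrightarrow> EdgeV {u, v} \<in> verts (GH H)"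
  by (simp add: GH_def EdgeV_in_clique[OF H])

lemma GH_in_h21_iff: "in_h21 h (GH H) \<longleftrightarrow> colorable h H"
proof
  assume "in_h21 h (GH H)"
  then have "\<exists>c. (\<forall>v. c v < h) \<and> (\<forall>u v. (u, v) \<in> parcs H \<longrightarrow> c u \<noteq> c v)"
    using GH_induced_coloring[OF H induced_in_refl, of h "\<lambda>u v. (u, v) \<in> parcs H"]
      h nb_sym[OF H] GH_own_nb nb_verts[OF H] EdgeV_in_GH
    by (simp add: GH_def Int_absorb2)
  then show "colorable h H" unfolding colorable_def by auto
next
  assume "colorable h H"
  then obtain c where "\<And>v. v \<in> pverts H \<Longrightarrow> c v < h" "\<And>u v. (u, v) \<in> parcs H \<Longrightarrow> c u \<noteq> c v"
    unfolding colorable_def by auto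
  then show "in_h21 h (GH H)"
    by (intro GH_induced_in_h21[OF H induced_in_refl GH_graph[OF H] h, of c])
      (auto simp: GH_def GH_clique_def)
qed

text \<open>The clique stays whole, so \<open>GH_own_nb\<close> still applies to the edges not at
  \<open>b\<close>. An edge vertex at \<open>b\<close> keeps a single stable neighbour and imposes
  no condition on a colouring.\<close>

lemma GH_del_Orig_iff:
  assumes "b \<in> pverts H"
  shows "in_h21 h (pre_digraph.del_vert (GH H) (Orig b)) \<longleftrightarrow> colorable h (pre_digraph.del_vert H b)"
    (is "in_h21 h ?G \<longleftrightarrow> _")
proof
  assume G: "in_h21 h ?G"
  have "\<exists>c. (\<forall>v. c v < h) \<and> (\<forall>u v. (u, v) \<in> parcs H \<and> u \<noteq> b \<and> v \<noteq> b \<longrightarrow> c u \<noteq> c v)"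
  proof (rule GH_induced_coloring[OF H induced_in_del_vert G])
    fix u v assume uv: "(u, v) \<in> parcs H \<and> u \<noteq> b \<and> v \<noteq> b"
    show "(v, u) \<in> parcs H \<and> v \<noteq> b \<and> u \<noteq> b" using uv nb_sym[OF H] by blast
    show "(u, v) \<in> parcs H \<and> Orig u \<in> verts ?G \<and> Orig v \<in> verts ?G \<and> EdgeV {u, v} \<in> verts ?G"
      using uv nb_verts[OF H] EdgeV_in_GH by (auto simp: GH_def)
    have "GH_clique H \<subseteq> verts ?G"
      using Orig_notin_clique[OF H] by (auto simp: GH_def)
    then show "\<exists>k\<in>GH_clique H \<inter> verts ?G. (Orig u, k) \<in> GH_cross H \<and> (Orig v, k) \<notin> GH_cross H"
      using GH_own_nb uv by blast
  qed (use h in simp)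
  then show "colorable h (pre_digraph.del_vert H b)"
    unfolding colorable_def by auto
next
  assume "colorable h (pre_digraph.del_vert H b)"
  then obtain c where c: "\<And>v. v \<in> pverts H \<Longrightarrow> v \<noteq> b \<Longrightarrow> c v < h"
    "\<And>u v. (u, v) \<in> parcs H \<Longrightarrow> u \<noteq> b \<Longrightarrow> v \<noteq> b \<Longrightarrow> c u \<noteq> c v"
    by (rule del_vert_coloring[OF H]) blast
  show "in_h21 h ?G"
    by (rule GH_induced_in_h21[OF H induced_in_del_vert graph_del_vert[OF GH_graph[OF H]] h, of _ c])
      (use c in \<open>auto simp: GH_def GH_clique_def\<close>)
qed

text \<open>Without its edge vertex no clique vertex is adjacent to both \<open>a\<close> and
  \<open>b\<close>, so they may share a colour.\<close>

lemma GH_del_EdgeV_in_h21: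
  assumes "colorable h (del_edge H a b)"
  shows "in_h21 h (pre_digraph.del_vert (GH H) (EdgeV {a, b}))"
proof -
  obtain c where "\<forall>v\<in>verts (del_edge H a b). c v < h"
    "\<forall>u v. u \<rightarrow>\<^bsub>del_edge H a b\<^esub> v \<longrightarrow> c u \<noteq> c v"
    using assms unfolding colorable_def by blast
  then have c: "\<And>v. v \<in> pverts H \<Longrightarrow> c v < h"
    "\<And>u v. (u, v) \<in> parcs H \<Longrightarrow> {u, v} \<noteq> {a, b} \<Longrightarrow> c u \<noteq> c v"
    by simp_all
  show ?thesis
    by (rule GH_induced_in_h21[OF H induced_in_del_vert graph_del_vert[OF GH_graph[OF H]] h, of _ c])
      (use c in \<open>auto simp: GH_def GH_clique_def\<close>)
qed

lemma colorable_del_edge: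
  assumes G: "in_h21 h (pre_digraph.del_vert (GH H) (EdgeV {a, b}))" (is "in_h21 h ?G")
    and deg: "\<And>u. u \<in> pverts H \<Longrightarrow> out_degree H u \<ge> 3"
  shows "colorable h (del_edge H a b)"
proof -
  have "\<exists>c. (\<forall>v. c v < h) \<and> (\<forall>u v. (u, v) \<in> parcs H \<and> {u, v} \<noteq> {a, b} \<longrightarrow> c u \<noteq> c v)"
  proof (rule GH_induced_coloring[OF H induced_in_del_vert G])
    fix u v assume uv: "(u, v) \<in> parcs H \<and> {u, v} \<noteq> {a, b}"
    show "(v, u) \<in> parcs H \<and> {v, u} \<noteq> {a, b}" using uv nb_sym[OF H, of u v] by (metis insert_commute)
    have V: "u \<in> pverts H" "v \<in> pverts H" using uv nb_verts[OF H] by auto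
    then show "(u, v) \<in> parcs H \<and> Orig u \<in> verts ?G \<and> Orig v \<in> verts ?G \<and> EdgeV {u, v} \<in> verts ?G"
      using uv EdgeV_in_GH by (auto simp: GH_def)
    \<comment> \<open>At an end of the deleted edge the second element is its other end, elsewhere
      it is a harmless exclusion. Three neighbours of \<open>u\<close> leave some \<open>w\<close>
      outside this pair, whose edge vertex survives and is not adjacent to \<open>v\<close>.\<close>
    have "\<not> {w. (u, w) \<in> parcs H} \<subseteq> {v, if u = a then b else a}"
    proof
      assume "{w. (u, w) \<in> parcs H} \<subseteq> {v, if u = a then b else a}"
      then have "card {w. (u, w) \<in> parcs H} \<le> card {v, if u = a then b else a}"
        by (intro card_mono) auto
      also have "\<dots> \<le> 2" by (simp add: card_insert_if)
      finally show False using deg[OF V(1)] unfolding out_degree_conv[OF H] by simp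
    qed
    then obtain w where w: "(u, w) \<in> parcs H" "w \<noteq> v" "w \<noteq> (if u = a then b else a)" by blast
    then have "{u, w} \<noteq> {a, b}" by (auto simp: doubleton_eq_iff split: if_splits)
    then have "EdgeV {u, w} \<in> GH_clique H \<inter> verts ?G"
      using w EdgeV_in_GH by (auto simp: EdgeV_in_clique[OF H])
    moreover have "u \<noteq> v" using uv nb_irrefl[OF H] by blast
    ultimately show "\<exists>k\<in>GH_clique H \<inter> verts ?G. (Orig u, k) \<in> GH_cross H \<and> (Orig v, k) \<notin> GH_cross H"
      using w by (intro bexI[of _ "EdgeV {u, w}"]) (auto simp: GH_cross_EdgeV[OF H])
  qed (use h in simp)
  then show ?thesis unfolding colorable_def by auto
qed

lemma chromatic_number_less_Suc:
  "chromatic_number (pre_digraph.del_vert H x) < h + 1 \<longleftrightarrow> colorable h (pre_digraph.del_vert H x)"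
  "chromatic_number (del_edge H x y) < h + 1 \<longleftrightarrow> colorable h (del_edge H x y)"
proof -
  obtain k where k: "colorable k H" using pair_graph_colorable[OF H] by blast
  show "chromatic_number (pre_digraph.del_vert H x) < h + 1 \<longleftrightarrow> colorable h (pre_digraph.del_vert H x)"
    using chromatic_number_le_iff[OF colorable_del(1)[OF k], of x h] by linarith
  show "chromatic_number (del_edge H x y) < h + 1 \<longleftrightarrow> colorable h (del_edge H x y)"
    using chromatic_number_le_iff[OF colorable_del(2)[OF k], of x y h] by linarith
qed

lemma chromatic_number_eq_Suc:
  "chromatic_number H = h + 1 \<longleftrightarrow> colorable (h + 1) H \<and> \<not> colorable h H"
proof -
  obtain k where "colorable k H" using pair_graph_colorable[OF H] by blast
  from chromatic_number_le_iff[OF this, of h] chromatic_number_le_iff[OF this, of "h + 1"]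
  show ?thesis by linarith
qed

end

theorem theorem18:
  fixes h :: nat and H :: "'a pair_pre_digraph"
  assumes "h \<ge> 3" and "pair_graph H" and "connected H"
  shows "minimal_non_h21 h (GH H) \<longleftrightarrow> critical (h + 1) H"
proof
  note h = assms(1) and H = assms(2)
  note number = chromatic_number_less_Suc[OF H h] chromatic_number_eq_Suc[OF H h]
  {
    assume min: "minimal_non_h21 h (GH H)"
    then have non: "\<not> colorable h H"
      unfolding minimal_non_h21_def using GH_in_h21_iff[OF H h] by blast
    have del: "in_h21 h (pre_digraph.del_vert (GH H) x)" if "x \<in> verts (GH H)" for x
      using min that unfolding minimal_non_h21_def by blast
    have vert: "colorable h (pre_digraph.del_vert H b)" if "b \<in> pverts H" for b
      using del[of "Orig b"] GH_del_Orig_iff[OF H h that] that by (simp add: GH_def)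
    have deg: "out_degree H b \<ge> 3" if "b \<in> pverts H" for b
    proof (rule ccontr)
      assume "\<not> out_degree H b \<ge> 3"
      then show False using colorable_del_vert_low_degree[OF H vert[OF that]] non h by simp
    qed
    \<comment> \<open>A graph without vertices would be \<open>h\<close>-colourable. Deleting any
      vertex and giving it a new colour then yields \<open>h + 1\<close> colours.\<close>
    have "pverts H \<noteq> {}"
      using non nb_verts[OF H] unfolding colorable_def by auto
    then have "colorable (h + 1) H"
      using colorable_Suc_del_vert[OF H] vert by fastforce
    then show "critical (h + 1) H"
      unfolding critical_def number
      using non vert colorable_del_edge[OF H h _ deg] del EdgeV_in_GH[OF H h] by simp
  next
    assume crit: "critical (h + 1) H"
    then have non: "\<not> colorable h H"
      and vert: "\<And>b. b \<in> pverts H \<Longrightarrow> colorable h (pre_digraph.del_vert H b)"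
      and edge: "\<And>a b. (a, b) \<in> parcs H \<Longrightarrow> colorable h (del_edge H a b)"
      unfolding critical_def number by auto
    have "in_h21 h (pre_digraph.del_vert (GH H) x)" if x: "x \<in> verts (GH H)" for x
    proof -
      consider (Orig) b where "x = Orig b" "b \<in> pverts H" | (clique) "x \<in> GH_clique H"
        using x by (auto simp: GH_def)
      then show ?thesis
      proof cases
        case Orig
        then show ?thesis using GH_del_Orig_iff[OF H h] vert by simp
      next
        case clique
        then show ?thesis
        proof (cases rule: GH_cliqueE)
          case (EdgeV u v)
          then show ?thesis using GH_del_EdgeV_in_h21[OF H h] edge by simp
        next
          \<comment> \<open>This case is void: a vertex of degree 1 could be recoloured, making
            \<open>H\<close> itself \<open>h\<close>-colourable.\<close>
          case (Tilde v)
          then show ?thesis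
            using colorable_del_vert_low_degree[OF H vert[of v]] non h by simp
        qed
      qed
    qed
    then show "minimal_non_h21 h (GH H)"
      unfolding minimal_non_h21_def using GH_graph[OF H] GH_in_h21_iff[OF H h] non by blast
  }
qed

end
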